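(* Let $\nu > -1$ and let $H_1, H_2 \in \mathbb{R}\cup\{\infty\}$ be such that $H_1 \neq H_2$. Then for every integer $n \ge \chi_{\{H_1+\nu>0\}}$, $$ \sum_{k \ge \chi_{\{H_2+\nu > 0\}}} \frac{\big|b_{n,k}^{\nu,H_1,H_2}\big|^2}{\Big[(-1)^{\chi_{\{n=0\}}} \big(j_n^{\nu,H_1}\big)^2 -(-1)^{\chi_{\{k=0\}}}\big(j_k^{\nu,H_2}\big)^2\Big]^2} = 1 . $$
   Context: For a condition, $\chi_{\{\text{condition}\}}$ equals $1$ if the condition is true and $0$ if it is false; $\infty+\nu>0$ is regarded as true. $J_\nu$ and $I_\nu$ are the Bessel function and the modified Bessel function of the first kind of order $\nu$, considered on $(0,\infty)$; $\nu>-1$. For $H\in\mathbb{R}$ put $J_{\nu,H}(x) := xJ_\nu'(x)+HJ_\nu(x)$ and $I_{\nu,H}(x) := xI_\nu'(x)+HI_\nu(x)$; also $J_{\nu,\infty}:=J_\nu$, $I_{\nu,\infty}:=I_\nu$. For $H\in\mathbb{R}\cup\{\infty\}$, $\{j_n^{\nu,H}: n\ge1\}$ denotes the sequence of strictly positive zeros of $J_{\nu,H}$ in ascending order; $j_n^{\nu}:=j_n^{\nu,\infty}$. If $H+\nu<0$, then $I_{\nu,H}$ has exactly one strictly positive zero, denoted $j_0^{\nu,H}$. If $H+\nu=0$, put $j_0^{\nu,H}:=0$. Constants: $c_n^{\nu,\infty} := \dfrac{\sqrt2}{|J_{\nu+1}(j_n^{\nu})|}$ for $n\ge1$; for $H\in\mathbb{R}$,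 $c_n^{\nu,H} := \dfrac{\sqrt2}{|J_\nu(j_n^{\nu,H})|}\dfrac{j_n^{\nu,H}}{\sqrt{(j_n^{\nu,H})^2-\nu^2+H^2}}$ for $n\ge1$; and if $H+\nu<0$, $c_0^{\nu,H} := \dfrac{\sqrt2}{I_\nu(j_0^{\nu,H})}\dfrac{j_0^{\nu,H}}{\sqrt{(j_0^{\nu,H})^2+\nu^2-H^2}}$. (These are well-defined and strictly positive.) Coefficients: for $n\ge\chi_{\{H_1+\nu\ge0\}}$ and $k\ge\chi_{\{H_2+\nu\ge0\}}$, $$ b_{n,k}^{\nu,H_1,H_2} := c_n^{\nu,H_1}c_k^{\nu,H_2}\Big[j_n^{\nu,H_1}J_{\nu+1}(j_n^{\nu,H_1})J_\nu(j_k^{\nu,H_2}) - j_k^{\nu,H_2}J_\nu(j_n^{\nu,H_1})J_{\nu+1}(j_k^{\nu,H_2})\Big], $$ with the convention that when $n=0$ the functions $J_\nu,J_{\nu+1}$ evaluated at $j_0^{\nu,H_1}$ are replaced by $I_\nu,I_{\nu+1}$, respectively, and when $k=0$ the functions $J_\nu,J_{\nu+1}$ evaluated at $j_0^{\nu,H_2}$ are replaced by $I_\nu,I_{\nu+1}$, respectively. With the same convention, in the corner cases: $$ b_{n,k}^{\nu,H_1,H_2} := \begin{cases} -(-1)^{\chi_{\{k=0\}}}\sqrt{2(\nu+1)}\,c_k^{\nu,H_2}j_k^{\nu,H_2}J_{\nu+1}(j_k^{\nu,H_2}) & \text{if } H_1+\nu=n=0 \text{ and } k\ge\chi_{\{H_2+\nu\ge0\}},\\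 (-1)^{\chi_{\{n=0\}}}\sqrt{2(\nu+1)}\,c_n^{\nu,H_1}j_n^{\nu,H_1}J_{\nu+1}(j_n^{\nu,H_1}) & \text{if } H_2+\nu=k=0 \text{ and } n\ge\chi_{\{H_1+\nu\ge0\}}.\end{cases} $$
   Formalization: In the generic formula for b_{n,k} the two terms in the bracket carry the signs (-1)^{χ_{n=0}} and (-1)^{χ_{k=0}}; as printed the claim fails, e.g. for n=0, H_1+ν=-s<0, H_2+ν=s>0 all b_{0,k} vanish. *)

theory Defs
  imports "HOL-Analysis.Analysis"
begin

definition bessel_J :: "real \<Rightarrow> real \<Rightarrow> real" where
  "bessel_J \<nu> x = (\<Sum>m. (- 1) ^ m / (fact m * Gamma (real m + \<nu> + 1)) * (x / 2) powr (2 * real m + \<nu>))"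

definition bessel_I :: "real \<Rightarrow> real \<Rightarrow> real" where
  "bessel_I \<nu> x = (\<Sum>m. 1 / (fact m * Gamma (real m + \<nu> + 1)) * (x / 2) powr (2 * real m + \<nu>))"

(* The parameter H ranges over the reals together with \<infinity>; it is an ereal other than -\<infinity>. *)

definition bessel_JH :: "real \<Rightarrow> ereal \<Rightarrow> real \<Rightarrow> real" where
  "bessel_JH \<nu> H x =
     (if H = \<infinity> then bessel_J \<nu> x
      else x * deriv (bessel_J \<nu>) x + real_of_ereal H * bessel_J \<nu> x)"

definition bessel_IH :: "real \<Rightarrow> ereal \<Rightarrow> real \<Rightarrow> real" where
  "bessel_IH \<nu> H x =
     (if H = \<infinity> then bessel_I \<nu> x
      else x * deriv (bessel_I \<nu>) x + real_of_ereal H * bessel_I \<nu> x)"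

(* For n \<ge> 1 this is the n-th positive zero of bessel_JH \<nu> H in ascending order: the zero x
   such that exactly n zeros lie in (0, x]. (Since n > 0, the condition card _ = n forces
   that set to be finite.) For n = 0 it is only meaningful when H + \<nu> \<le> 0. *)
definition bessel_zero :: "real \<Rightarrow> ereal \<Rightarrow> nat \<Rightarrow> real" where
  "bessel_zero \<nu> H n =
     (if n = 0 then
        (if H + ereal \<nu> = 0 then 0 else (THE x. 0 < x \<and> bessel_IH \<nu> H x = 0))
      else
        (THE x. 0 < x \<and> bessel_JH \<nu> H x = 0 \<and>
                card {y. 0 < y \<and> y \<le> x \<and> bessel_JH \<nu> H y = 0} = n))"

(* For n = 0 only meaningful when H + \<nu> < 0. *)
definition bessel_const :: "real \<Rightarrow> ereal \<Rightarrow> nat \<Rightarrow> real" where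
  "bessel_const \<nu> H n =
     (let j = bessel_zero \<nu> H n; h = real_of_ereal H in
      if n = 0 then sqrt 2 / bessel_I \<nu> j * (j / sqrt (j\<^sup>2 + \<nu>\<^sup>2 - h\<^sup>2))
      else if H = \<infinity> then sqrt 2 / \<bar>bessel_J (\<nu> + 1) j\<bar>
      else sqrt 2 / \<bar>bessel_J \<nu> j\<bar> * (j / sqrt (j\<^sup>2 - \<nu>\<^sup>2 + h\<^sup>2)))"

(* At the zero of index 0, J is replaced by I. *)
definition bessel_JI :: "nat \<Rightarrow> real \<Rightarrow> real \<Rightarrow> real" where
  "bessel_JI n \<mu> x = (if n = 0 then bessel_I \<mu> x else bessel_J \<mu> x)"

(* (-1) to the power of the indicator of n = 0 *)
definition zero_sign :: "nat \<Rightarrow> real" where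
  "zero_sign n = (- 1) ^ of_bool (n = 0)"

(* The zero_sign factors in the last case come from the passage from J to I: with x I'(x) =
   \<nu> I(x) + x I_{\<nu>+1}(x) but x J'(x) = \<nu> J(x) - x J_{\<nu>+1}(x), replacing j J_{\<nu>+1}(j) at an
   index-0 zero produces - j I_{\<nu>+1}(j). They are 1 for n, k \<ge> 1, and for n = k = 0 they only
   change the sign of the coefficient. If they are omitted when exactly one of n, k is 0, the
   expansion identity for the coefficients fails: for finite H1, H2 with H1 + \<nu> < 0 and
   H1 + H2 + 2 * \<nu> = 0, the unsigned bracket vanishes for n = 0 and all k \<ge> 1. *)
definition bessel_coeff :: "real \<Rightarrow> ereal \<Rightarrow> ereal \<Rightarrow> nat \<Rightarrow> nat \<Rightarrow> real" where
  "bessel_coeff \<nu> H1 H2 n k =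
     (let x = bessel_zero \<nu> H1 n; y = bessel_zero \<nu> H2 k in
      if H1 + ereal \<nu> = 0 \<and> n = 0 then
        - zero_sign k * sqrt (2 * (\<nu> + 1)) * bessel_const \<nu> H2 k * y * bessel_JI k (\<nu> + 1) y
      else if H2 + ereal \<nu> = 0 \<and> k = 0 then
        zero_sign n * sqrt (2 * (\<nu> + 1)) * bessel_const \<nu> H1 n * x * bessel_JI n (\<nu> + 1) x
      else
        bessel_const \<nu> H1 n * bessel_const \<nu> H2 k *
          (zero_sign n * x * bessel_JI n (\<nu> + 1) x * bessel_JI k \<nu> y
           - zero_sign k * y * bessel_JI n \<nu> x * bessel_JI k (\<nu> + 1) y))"

end

theory Submission
  imports Defs "HOL-Complex_Analysis.Complex_Analysis"
begin

text \<open>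
  The sum is an instance of Parseval's identity, and the work lies in proving that the relevant
  orthogonal family is complete.

  \<^bold>\<open>One entire function.\<close>  In the variable \<open>z = x\<^sup>2\<close> for \<open>J\<close> and \<open>z = - x\<^sup>2\<close> for \<open>I\<close>, both Bessel functions are
  \<open>(x / 2) powr \<nu> * phi \<nu> z\<close> for the same entire function \<open>phi \<nu>\<close>.  The condition \<open>J\<^bsub>\<nu>,H\<^esub>(x) = 0\<close> or
  \<open>I\<^bsub>\<nu>,H\<^esub>(x) = 0\<close> becomes \<open>bdry \<nu> H z = 0\<close>, and the numbers \<open>zero_sign k * (bessel_zero \<nu> H k)\<^sup>2\<close>
  enumerate the real zeros of \<open>bdry \<nu> H\<close> without repetition (\<open>eigenvalue_bij_betw\<close>); the index 0 belongs to
  the zero in \<open>z \<le> 0\<close>.  Write \<open>F\<close> for \<open>bdry \<nu> H\<close>, \<open>G\<close> for the complementary function \<open>cobdry \<nu> H\<close>, and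
  \<open>K\<close> for the kernel \<open>bessel_ker \<nu>\<close>, for which \<open>(a - b) K(a,b) = G(a) F(b) - F(a) G(b)\<close> whatever \<open>H\<close> is.
  The coefficient \<open>b\<^bsub>n,k\<^esub>\<close> equals \<open>s\<^sub>n r\<^sub>k (a - t) K(a,t)\<close>, where \<open>a\<close> and \<open>t\<close> are the zeros of the two
  boundary functions with the indices \<open>n\<close> and \<open>k\<close>, \<open>s\<^sub>n\<^sup>2 K(a,a) = 1\<close> and \<open>r\<^sub>k\<^sup>2 K(t,t) = 1\<close>
  (\<open>bessel_coeff_scale\<close>, \<open>coeff_scale_square\<close>).  So the claim is
  \<open>K(a,a) = \<Sum> K(t,a)\<^sup>2 / K(t,t)\<close>, the sum extending over the zeros \<open>t\<close> of the second boundary function.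

  \<^bold>\<open>Positivity.\<close>  \<open>K(a,b)\<close> is half of \<open>\<integral> s\<^sup>\<nu> phi(as) phi(bs) ds\<close> over \<open>(0,1)\<close>, but integrals can be avoided:
  the three-term recurrence between \<open>phi \<nu>\<close>, \<open>phi (\<nu> + 1)\<close>, \<open>phi (\<nu> + 2)\<close> expresses \<open>K\<^sub>\<nu>\<close> by a positive
  rank-one kernel and \<open>K\<^bsub>\<nu>+2\<^esub>\<close>, and iterating it writes \<open>K\<close> as a series of such kernels
  (\<open>bessel_ker_sums\<close>).  Hence \<open>K(z, cnj z) > 0\<close>, so the zeros of \<open>F\<close> are real and simple; the functions \<open>K(t,\<cdot>)\<close> at
  different zeros \<open>t\<close> are orthogonal, and Bessel's inequality \<open>\<Sum> \<bar>K(t,z)\<bar>\<^sup>2 / K(t,t) \<le> K(z, cnj z)\<close> holds.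

  \<^bold>\<open>Completeness\<close> (\<open>bessel_ker_expansion\<close>).  Fix a real \<open>x\<close> with \<open>F(x) \<noteq> 0\<close>.  The residual
  \<open>D(z) = K(z,x) - \<Sum> K(t,x) K(t,z) / K(t,t)\<close> is entire and vanishes at all zeros of \<open>F\<close>, so
  \<open>E = D / (F F(x))\<close> is entire.  With \<open>m = G / F\<close>, the function \<open>(z - x) E(z)\<close> is \<open>m(z) - m(x)\<close> minus the
  partial fractions of \<open>m\<close>, and Bessel's inequality says precisely that its imaginary part has the sign of
  \<open>Im z\<close>.  The maximum principle and Liouville's theorem then make \<open>E\<close> a constant \<open>c\<close>
  (\<open>Herglotz_entire_constant\<close>).  This gives \<open>c F(y)\<^sup>2 \<le> K(y,y)\<close> for real \<open>y\<close>, that is \<open>c \<le> m'(y)\<close>, so a positive \<open>c\<close>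
  would force \<open>m\<close> to tend to \<open>-\<infinity>\<close> linearly as \<open>y \<rightarrow> -\<infinity>\<close>.  It does not: far out \<open>m\<close> is positive if
  \<open>H < \<infinity>\<close>, and it is \<open>o(\<bar>y\<bar>)\<close> if \<open>H = \<infinity>\<close>.  Hence \<open>c = 0\<close>.

  No asymptotic expansion of Bessel functions or of their zeros enters; that there are infinitely many
  positive zeros, so that every index \<open>k \<ge> 1\<close> names one, is itself read off from completeness.
\<close>

section \<open>The entire part of the Bessel functions\<close>

definition phi_coeff :: "real \<Rightarrow> nat \<Rightarrow> real" where
  "phi_coeff \<mu> m = (- 1 / 4) ^ m / (fact m * Gamma (real m + \<mu> + 1))"

text \<open>
  Up to the factor \<open>1 / Gamma (\<mu> + 1)\<close>, the hypergeometric function \<open>0F1(\<mu> + 1; - z / 4)\<close>.  The argument may be real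
  or complex: the zeros live on the real line, the completeness proof in the complex plane.
\<close>

definition phi :: "real \<Rightarrow> 'a \<Rightarrow> 'a::{real_normed_field,banach}" where
  "phi \<mu> z = (\<Sum>m. of_real (phi_coeff \<mu> m) * z ^ m)"

text \<open>
  The function \<open>x * J\<^bsub>\<nu>+1\<^esub>(x)\<close> with the factor \<open>(x / 2) powr \<nu>\<close> removed, written in \<open>z = x\<^sup>2\<close>; in \<open>z = - x\<^sup>2\<close> it
  corresponds to \<open>- x * I\<^bsub>\<nu>+1\<^esub>(x)\<close>.
\<close>

definition psi :: "real \<Rightarrow> 'a \<Rightarrow> 'a::{real_normed_field,banach}" where
  "psi \<mu> z = z * phi (\<mu> + 1) z / 2"

lemma phi_coeff_Suc:
  assumes "\<mu> > -1"
  shows "phi_coeff \<mu> (Suc m) = - phi_coeff \<mu> m / (4 * (real m + 1) * (real m + \<mu> + 1))"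
proof -
  have "Gamma (real m + \<mu> + 1 + 1) = (real m + \<mu> + 1) * Gamma (real m + \<mu> + 1)"
    using assms by (intro Gamma_plus1) (auto simp: nonpos_Ints_def)
  then show ?thesis
    by (simp add: phi_coeff_def field_simps)
qed

lemma phi_coeff_shift:
  assumes "\<mu> > -1"
  shows "phi_coeff (\<mu> + 1) m = phi_coeff \<mu> m / (real m + \<mu> + 1)"
proof -
  have "Gamma (real m + \<mu> + 1 + 1) = (real m + \<mu> + 1) * Gamma (real m + \<mu> + 1)"
    using assms by (intro Gamma_plus1) (auto simp: nonpos_Ints_def)
  then show ?thesis
    by (simp add: phi_coeff_def add_ac)
qed

lemma phi_summable:
  fixes z :: "'a::{real_normed_field,banach}"
  assumes "\<mu> > -1"
  shows "summable (\<lambda>m. of_real (phi_coeff \<mu> m) * z ^ m)"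
proof (rule summable_ratio_test[where c = "1/2" and N = "nat \<lceil>norm z\<rceil> + 1"])
  fix n :: nat
  assume n: "n \<ge> nat \<lceil>norm z\<rceil> + 1"
  have nz: "norm z \<le> real n" "real n \<ge> 1" using n by linarith+
  have pos: "real n + \<mu> + 1 > 0" using assms by linarith
  have le: "norm z / (4 * (real n + 1) * (real n + \<mu> + 1)) \<le> 1/2"
  proof -
    have "norm z * 1 \<le> (real n + 1) * (real n + \<mu> + 1)"
      using nz assms by (intro mult_mono) auto
    have half: "a / (4 * p * r) \<le> 1/2" if "a \<le> p * r" "p * r > 0" for a p r :: real
    proof -
      have "a / (4 * (p * r)) \<le> 1/2" using that by (subst pos_divide_le_eq) linarith+
      then show ?thesis by (simp add: mult.assoc)
    qed
    show ?thesis
      using \<open>norm z * 1 \<le> _\<close> nz pos by (intro half mult_pos_pos) auto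
  qed
  have "norm (of_real (phi_coeff \<mu> (Suc n)) * z ^ Suc n)
      = norm z / (4 * (real n + 1) * (real n + \<mu> + 1)) * norm (of_real (phi_coeff \<mu> n) * z ^ n)"
  proof -
    have *: "norm (of_real (phi_coeff \<mu> k) * z ^ k) = \<bar>phi_coeff \<mu> k\<bar> * norm z ^ k" for k
      by (simp add: norm_mult norm_power)
    show ?thesis
      unfolding * using pos by (simp add: phi_coeff_Suc[OF assms] abs_mult)
  qed
  also have "\<dots> \<le> 1/2 * norm (of_real (phi_coeff \<mu> n) * z ^ n)"
    by (intro mult_right_mono le) auto
  finally show "norm (of_real (phi_coeff \<mu> (Suc n)) * z ^ Suc n)
      \<le> 1/2 * norm (of_real (phi_coeff \<mu> n) * z ^ n)" .
qed auto

lemma phi_sums: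
  fixes z :: "'a::{real_normed_field,banach}"
  assumes "\<mu> > -1"
  shows "(\<lambda>m. of_real (phi_coeff \<mu> m) * z ^ m) sums phi \<mu> z"
  unfolding phi_def by (rule summable_sums[OF phi_summable[OF assms]])

lemma phi_of_real:
  assumes "\<mu> > -1"
  shows "phi \<mu> (of_real x) = (of_real (phi \<mu> x) :: 'a::{real_normed_field,banach})"
proof (rule sums_unique2[OF phi_sums[OF assms]])
  show "(\<lambda>m. of_real (phi_coeff \<mu> m) * of_real x ^ m) sums (of_real (phi \<mu> x) :: 'a)"
    using sums_of_real[OF phi_sums[OF assms, of x], where 'a = 'a] by simp
qed

lemma phi_cnj:
  assumes "\<mu> > -1"
  shows "phi \<mu> (cnj z) = cnj (phi \<mu> z)"
proof (rule sums_unique2[OF phi_sums[OF assms]])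
  show "(\<lambda>m. of_real (phi_coeff \<mu> m) * cnj z ^ m) sums cnj (phi \<mu> z)"
    using sums_cnj[THEN iffD2, OF phi_sums[OF assms, of z]] by simp
qed

lemma phi_0: "phi \<mu> 0 = (of_real (1 / Gamma (\<mu> + 1)) :: 'a::{real_normed_field,banach})"
  using powser_zero[of "\<lambda>m. of_real (phi_coeff \<mu> m) :: 'a"] by (simp add: phi_def phi_coeff_def)

lemma phi_0_nonzero:
  assumes "\<mu> > -1"
  shows "phi \<mu> 0 \<noteq> (0 :: 'a::{real_normed_field,banach})"
proof -
  have "Gamma (\<mu> + 1) > 0" using assms by (intro Gamma_real_pos) auto
  then show ?thesis by (simp add: phi_0)
qed

lemma phi_has_derivative:
  fixes z :: "'a::{real_normed_field,banach}"
  assumes "\<mu> > -1"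
  shows "(phi \<mu> has_field_derivative (- phi (\<mu> + 1) z / 4)) (at z)"
proof -
  have "diffs (\<lambda>m. of_real (phi_coeff \<mu> m)) m = (of_real (phi_coeff (\<mu> + 1) m) * (-1/4) :: 'a)" for m
  proof -
    have *: "real (Suc m) * phi_coeff \<mu> (Suc m) = phi_coeff (\<mu> + 1) m * (-1/4)"
      using assms by (simp add: phi_coeff_def add_ac)
    have "diffs (\<lambda>m. of_real (phi_coeff \<mu> m)) m = (of_real (real (Suc m) * phi_coeff \<mu> (Suc m)) :: 'a)"
      by (simp only: diffs_def of_real_mult of_real_of_nat_eq)
    then show ?thesis
      by (simp add: * del: of_nat_Suc)
  qed
  moreover have "(\<lambda>m. of_real (phi_coeff (\<mu> + 1) m) * z ^ m * (-1/4)) sums (phi (\<mu> + 1) z * (-1/4))"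
    by (intro sums_mult2 phi_sums) (use assms in auto)
  ultimately have *: "(\<Sum>m. diffs (\<lambda>m. of_real (phi_coeff \<mu> m)) m * z ^ m) = - phi (\<mu> + 1) z / 4"
    by (simp add: sums_iff mult_ac)
  have "((\<lambda>x. \<Sum>m. of_real (phi_coeff \<mu> m) * x ^ m) has_field_derivative
          (\<Sum>m. diffs (\<lambda>m. of_real (phi_coeff \<mu> m)) m * z ^ m)) (at z)"
    by (rule termdiffs_strong_converges_everywhere) (rule phi_summable[OF assms])
  then show ?thesis
    unfolding * by (simp add: phi_def[abs_def])
qed

lemmas phi_derivative_intros [derivative_intros] = DERIV_chain2[OF phi_has_derivative]

text \<open>
  The relation \<open>J\<^bsub>\<nu>-1\<^esub>(x) + J\<^bsub>\<nu>+1\<^esub>(x) = (2\<nu> / x) J\<^sub>\<nu>(x)\<close>, shifted by one and freed of powers of \<open>x\<close>;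
  it holds coefficient by coefficient.
\<close>

lemma phi_recurrence:
  fixes z :: "'a::{real_normed_field,banach}"
  assumes "\<mu> > -1"
  shows "phi \<mu> z = of_real (\<mu> + 1) * phi (\<mu> + 1) z - z / 4 * phi (\<mu> + 2) z"
proof -
  define c where "c = (\<lambda>m. case m of 0 \<Rightarrow> 0 | Suc k \<Rightarrow> of_real (phi_coeff (\<mu> + 2) k) * z ^ k * (- z / 4))"
  have "(\<lambda>k. c (Suc k)) sums (phi (\<mu> + 2) z * (- z / 4))"
    unfolding c_def nat.case by (intro sums_mult2 phi_sums) (use assms in auto)
  then have "c sums (phi (\<mu> + 2) z * (- z / 4))"
    by (subst (asm) sums_Suc_iff) (simp add: c_def)
  then have "(\<lambda>m. of_real (\<mu> + 1) * (of_real (phi_coeff (\<mu> + 1) m) * z ^ m) + c m) sums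
      (of_real (\<mu> + 1) * phi (\<mu> + 1) z + phi (\<mu> + 2) z * (- z / 4))"
    by (intro sums_add sums_mult phi_sums) (use assms in auto)
  moreover have "of_real (\<mu> + 1) * (of_real (phi_coeff (\<mu> + 1) m) * z ^ m) + c m
      = of_real (phi_coeff \<mu> m) * z ^ m" for m
  proof (cases m)
    case 0
    have "Gamma (\<mu> + 1 + 1) = (\<mu> + 1) * Gamma (\<mu> + 1)"
      using assms by (intro Gamma_plus1) (auto simp: nonpos_Ints_def)
    with assms have *: "(\<mu> + 1) * phi_coeff (\<mu> + 1) 0 = phi_coeff \<mu> 0"
      by (simp add: phi_coeff_def add_ac)
    show ?thesis
      unfolding 0 *[symmetric] by (simp add: c_def)
  next
    case (Suc k)
    define q where "q = phi_coeff \<mu> k"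
    have pos: "real k + \<mu> + 1 > 0" "real k + \<mu> + 2 > 0" using assms by linarith+
    have "phi_coeff \<mu> (Suc k) = - q / (4 * (real k + 1) * (real k + \<mu> + 1))"
      "phi_coeff (\<mu> + 2) k = q / ((real k + \<mu> + 1) * (real k + \<mu> + 2))"
      "phi_coeff (\<mu> + 1) (Suc k) = - q / (4 * (real k + 1) * (real k + \<mu> + 1)) / (real k + \<mu> + 2)"
      using phi_coeff_Suc[OF assms, of k] phi_coeff_shift[of "\<mu> + 1" k] phi_coeff_shift[OF assms, of k]
        phi_coeff_shift[OF assms, of "Suc k"] assms
      by (simp_all add: q_def add_ac)
    moreover have "(C - A) * (- q / (4 * A * B) / C) - q / (B * C) / 4 = - q / (4 * A * B)"
      if "A > 0" "B > 0" "C > 0" for A B C :: real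
      using that by (simp add: field_simps)
    from this[of "real k + 1", OF _ pos]
    have "(\<mu> + 1) * (- q / (4 * (real k + 1) * (real k + \<mu> + 1)) / (real k + \<mu> + 2))
        - q / ((real k + \<mu> + 1) * (real k + \<mu> + 2)) / 4
        = - q / (4 * (real k + 1) * (real k + \<mu> + 1))" by simp
    ultimately have *: "(\<mu> + 1) * phi_coeff (\<mu> + 1) (Suc k) - phi_coeff (\<mu> + 2) k / 4 = phi_coeff \<mu> (Suc k)"
      by metis
    show ?thesis
      unfolding Suc *[symmetric] by (simp add: c_def algebra_simps)
  qed
  ultimately have "(\<lambda>m. of_real (phi_coeff \<mu> m) * z ^ m) sums
      (of_real (\<mu> + 1) * phi (\<mu> + 1) z + phi (\<mu> + 2) z * (- z / 4))" by simp
  from sums_unique2[OF phi_sums[OF assms] this] show ?thesis by (simp add: algebra_simps)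
qed

lemma Gamma_mono_shift:
  assumes "\<mu> \<ge> 0"
  shows "Gamma (\<mu> + 1) \<le> Gamma (real m + \<mu> + 1)"
proof (induction m)
  case (Suc m)
  have "Gamma (real m + \<mu> + 1 + 1) = (real m + \<mu> + 1) * Gamma (real m + \<mu> + 1)"
    using assms by (intro Gamma_plus1) (auto simp: nonpos_Ints_def)
  moreover have "1 * Gamma (real m + \<mu> + 1) \<le> (real m + \<mu> + 1) * Gamma (real m + \<mu> + 1)"
    using assms by (intro mult_right_mono less_imp_le[OF Gamma_real_pos]) auto
  ultimately show ?case using Suc by (simp add: add_ac)
qed auto

text \<open>
  Comparison with the exponential series.  What matters is the decay like \<open>1 / Gamma (\<mu> + 1)\<close> in \<open>\<mu>\<close>: it lets
  the remainder vanish when the kernel recurrence is iterated.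
\<close>

lemma norm_phi_le:
  fixes z :: "'a::{real_normed_field,banach}"
  assumes "\<mu> \<ge> 0"
  shows "norm (phi \<mu> z) \<le> exp (norm z / 4) / Gamma (\<mu> + 1)"
proof -
  have "(\<lambda>m. (norm z / 4) ^ m /\<^sub>R fact m * (1 / Gamma (\<mu> + 1))) sums (exp (norm z / 4) * (1 / Gamma (\<mu> + 1)))"
    by (intro sums_mult2 exp_converges)
  moreover have "norm (of_real (phi_coeff \<mu> m) * z ^ m) \<le> (norm z / 4) ^ m /\<^sub>R fact m * (1 / Gamma (\<mu> + 1))" for m
  proof -
    have G: "Gamma (\<mu> + 1) > 0" "Gamma (real m + \<mu> + 1) > 0"
      using assms by (auto intro!: Gamma_real_pos)
    have "norm (of_real (phi_coeff \<mu> m) * z ^ m) = \<bar>phi_coeff \<mu> m\<bar> * norm z ^ m"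
      by (simp add: norm_mult norm_power)
    also have "\<dots> = (norm z / 4) ^ m / fact m * (1 / Gamma (real m + \<mu> + 1))"
      using G by (simp add: phi_coeff_def abs_mult power_divide power_abs)
    also have "\<dots> \<le> (norm z / 4) ^ m / fact m * (1 / Gamma (\<mu> + 1))"
      using G Gamma_mono_shift[OF assms, of m] by (intro mult_left_mono) (auto simp: frac_le)
    finally show ?thesis by (simp add: field_simps)
  qed
  ultimately have "norm (phi \<mu> z) \<le> exp (norm z / 4) * (1 / Gamma (\<mu> + 1))"
    unfolding phi_def by (metis (no_types, lifting) norm_suminf_le sums_iff)
  then show ?thesis by simp
qed

text \<open>
  On the half-line \<open>x \<le> 0\<close>, where \<open>phi\<close> describes the modified Bessel function, all terms have the same sign.
\<close>

lemma phi_nonpos_pos: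
  fixes x :: real
  assumes "\<mu> > -1" "x \<le> 0"
  shows "phi \<mu> x > 0"
proof -
  have "phi_coeff \<mu> m * x ^ m = (- x / 4) ^ m / (fact m * Gamma (real m + \<mu> + 1))" for m
    by (simp add: phi_coeff_def power_mult_distrib[symmetric])
  moreover have "Gamma (real m + \<mu> + 1) > 0" for m
    using assms by (intro Gamma_real_pos) auto
  ultimately have "phi_coeff \<mu> m * x ^ m \<ge> 0" for m
    using assms by (simp add: less_imp_le)
  moreover have "phi_coeff \<mu> 0 > 0"
    using assms by (simp add: phi_coeff_def Gamma_real_pos)
  ultimately show ?thesis
    using phi_summable[OF assms(1), of x] suminf_pos2[of "\<lambda>m. phi_coeff \<mu> m * x ^ m" 0]
    by (simp add: phi_def)
qed

section \<open>The reproducing kernel\<close>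

text \<open>
  The value on the diagonal is the limit \<open>phi * psi' - phi' * psi\<close>, with the derivatives expressed by
  \<open>phi (\<nu> + 1)\<close> and \<open>phi (\<nu> + 2)\<close>.
\<close>

definition bessel_ker :: "real \<Rightarrow> 'a \<Rightarrow> 'a \<Rightarrow> 'a::{real_normed_field,banach}" where
  "bessel_ker \<nu> a b =
     (if a = b then phi \<nu> a * (phi (\<nu> + 1) a / 2 - a * phi (\<nu> + 2) a / 8) + phi (\<nu> + 1) a / 4 * psi \<nu> a
      else (phi \<nu> b * psi \<nu> a - phi \<nu> a * psi \<nu> b) / (a - b))"

lemma bessel_ker_mult:
  "(a - b) * bessel_ker \<nu> a b = phi \<nu> b * psi \<nu> a - phi \<nu> a * psi \<nu> b"
  by (simp add: bessel_ker_def)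

lemma bessel_ker_commute: "bessel_ker \<nu> a b = bessel_ker \<nu> b a"
  by (simp add: bessel_ker_def divide_simps) (simp add: algebra_simps)

text \<open>
  With all functions expressed by two neighbouring ones through \<open>phi_recurrence\<close>, this is a polynomial
  identity.  The first term on the right is a rank-one kernel with the positive factor \<open>(\<nu> + 1) / 2\<close>, so that
  iteration yields positive definiteness.
\<close>

lemma bessel_ker_recurrence:
  fixes a b :: "'a::{real_normed_field,banach}"
  assumes "\<nu> > -1"
  shows "bessel_ker \<nu> a b = of_real ((\<nu> + 1) / 2) * phi (\<nu> + 1) a * phi (\<nu> + 1) b
           + a * b / 16 * bessel_ker (\<nu> + 2) a b"
proof -
  define c :: 'a where "c = of_real (\<nu> + 1)"
  have recurrence: "phi \<nu> z = c * phi (\<nu> + 1) z - z / 4 * phi (\<nu> + 2) z"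
    "phi (\<nu> + 1) z = (c + 1) * phi (\<nu> + 2) z - z / 4 * phi (\<nu> + 3) z"
    "phi (\<nu> + 2) z = (c + 2) * phi (\<nu> + 3) z - z / 4 * phi (\<nu> + 4) z" for z :: 'a
    using phi_recurrence[of \<nu> z] phi_recurrence[of "\<nu> + 1" z] phi_recurrence[of "\<nu> + 2" z] assms
    by (simp_all add: c_def add_ac)
  have shift: "\<nu> + 2 + 1 = \<nu> + 3" "\<nu> + 2 + 2 = \<nu> + 4" "\<nu> + 3 + 1 = \<nu> + 4" by simp_all
  have c: "of_real ((\<nu> + 1) / 2) = c / 2" by (simp add: c_def)
  show ?thesis
  proof (cases "a = b")
    case True
    have alg: "p0 * (p1 / 2 - x * p2 / 8) + p1 / 4 * (x * p1 / 2)
        = c / 2 * p1 * p1 + x * x / 16 * (p2 * (p3 / 2 - x * p4 / 8) + p3 / 4 * (x * p3 / 2))"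
      if "p0 = c * p1 - x / 4 * p2" "p1 = (c + 1) * p2 - x / 4 * p3" "p2 = (c + 2) * p3 - x / 4 * p4"
      for p0 p1 p2 p3 p4 x :: 'a
      unfolding that by (simp add: field_simps)
    show ?thesis
      unfolding True bessel_ker_def psi_def shift c if_True by (simp only: refl if_True alg[OF recurrence])
  next
    case False
    then have ab: "a - b \<noteq> 0" by simp
    have alg: "q0 * (x * p1 / 2) - p0 * (y * q1 / 2)
        = (x - y) * (c / 2 * p1 * q1) + x * y / 16 * (q2 * (x * p3 / 2) - p2 * (y * q3 / 2))"
      if "p0 = c * p1 - x / 4 * p2" "p1 = (c + 1) * p2 - x / 4 * p3"
        "q0 = c * q1 - y / 4 * q2" "q1 = (c + 1) * q2 - y / 4 * q3"
      for p0 p1 p2 p3 q0 q1 q2 q3 x y :: 'a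
      unfolding that by (simp add: field_simps)
    have "(a - b) * bessel_ker \<nu> a b
        = (a - b) * (c / 2 * phi (\<nu> + 1) a * phi (\<nu> + 1) b) + a * b / 16 * ((a - b) * bessel_ker (\<nu> + 2) a b)"
      unfolding bessel_ker_mult psi_def shift
      by (rule alg[OF recurrence(1,2) recurrence(1,2)])
    also have "\<dots> = (a - b) * (of_real ((\<nu> + 1) / 2) * phi (\<nu> + 1) a * phi (\<nu> + 1) b
           + a * b / 16 * bessel_ker (\<nu> + 2) a b)"
      unfolding c by (simp only: distrib_left mult.left_commute[of _ "a - b"])
    finally show ?thesis using ab by simp
  qed
qed

text \<open>
  The feature vectors of the kernel: by \<open>bessel_ker_sums\<close>, \<open>bessel_ker \<nu> a b\<close> is the weighted scalar product of the
  sequences \<open>\<lambda>j. ker_feature \<nu> j a\<close> and \<open>\<lambda>j. ker_feature \<nu> j b\<close>.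
\<close>

definition ker_feature :: "real \<Rightarrow> nat \<Rightarrow> 'a \<Rightarrow> 'a::{real_normed_field,banach}" where
  "ker_feature \<nu> j z = (z / 4) ^ j * phi (\<nu> + 1 + 2 * real j) z"

lemma bessel_ker_partial_sum:
  fixes a b :: "'a::{real_normed_field,banach}"
  assumes "\<nu> > -1"
  shows "bessel_ker \<nu> a b = (\<Sum>j<N. of_real ((\<nu> + 1) / 2 + real j) * ker_feature \<nu> j a * ker_feature \<nu> j b)
           + (a * b / 16) ^ N * bessel_ker (\<nu> + 2 * real N) a b"
proof (induction N)
  case (Suc N)
  have *: "bessel_ker (\<nu> + 2 * real N) a b
      = of_real ((\<nu> + 1) / 2 + real N) * phi (\<nu> + 1 + 2 * real N) a * phi (\<nu> + 1 + 2 * real N) b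
        + a * b / 16 * bessel_ker (\<nu> + 2 * real (Suc N)) a b"
    using bessel_ker_recurrence[of "\<nu> + 2 * real N" a b] assms
    by (simp add: algebra_simps add_divide_distrib)
  have "(a * b / 16) ^ N = (a / 4) ^ N * (b / 4) ^ N"
    by (simp add: power_mult_distrib[symmetric])
  then have "(a * b / 16) ^ N * bessel_ker (\<nu> + 2 * real N) a b
      = of_real ((\<nu> + 1) / 2 + real N) * ker_feature \<nu> N a * ker_feature \<nu> N b
        + (a * b / 16) ^ Suc N * bessel_ker (\<nu> + 2 * real (Suc N)) a b"
    unfolding * ker_feature_def power_Suc by (simp only: distrib_left mult_ac)
  with Suc show ?case by simp
qed simp

lemma bessel_ker_bound:
  fixes a b :: "'a::{real_normed_field,banach}"
  obtains C where "\<And>\<mu>. \<mu> \<ge> 0 \<Longrightarrow> norm (bessel_ker \<mu> a b) \<le> C * (1 / Gamma (\<mu> + 1))\<^sup>2"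
proof -
  define E where "E = exp ((norm a + norm b) / 4)"
  have phi: "norm (phi (\<mu> + real m) z) \<le> E * (1 / Gamma (\<mu> + 1))" if "\<mu> \<ge> 0" "z = a \<or> z = b" for \<mu> m z
  proof -
    have "Gamma (\<mu> + 1) \<le> Gamma (\<mu> + real m + 1)" "Gamma (\<mu> + 1) > 0"
      using Gamma_mono_shift[OF that(1), of m] that(1) by (auto simp: add_ac intro: Gamma_real_pos)
    moreover have "exp (norm z / 4) \<le> E" using that by (auto simp: E_def)
    ultimately have "exp (norm z / 4) / Gamma (\<mu> + real m + 1) \<le> E / Gamma (\<mu> + 1)"
      by (intro frac_le) (auto simp: E_def)
    with norm_phi_le[of "\<mu> + real m" z] that show ?thesis by simp
  qed
  define C where "C = (if a = b then (1/2 + norm a / 8) + norm a / 8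
                       else (norm a / 2 + norm b / 2) / norm (a - b)) * E\<^sup>2"
  show ?thesis
  proof (rule that[of C])
    fix \<mu> :: real
    assume \<mu>: "\<mu> \<ge> 0"
    define g where "g = E * (1 / Gamma (\<mu> + 1))"
    have g: "g \<ge> 0" using \<mu> by (simp add: g_def E_def Gamma_real_pos less_imp_le)
    have P: "norm (phi \<mu> z) \<le> g" "norm (phi (\<mu> + 1) z) \<le> g" "norm (phi (\<mu> + 2) z) \<le> g"
      if "z = a \<or> z = b" for z
      using phi[OF \<mu> that, of 0] phi[OF \<mu> that, of 1] phi[OF \<mu> that, of 2] by (simp_all add: g_def)
    have C: "C * (1 / Gamma (\<mu> + 1))\<^sup>2 = (if a = b then (1/2 + norm a / 8) + norm a / 8
                       else (norm a / 2 + norm b / 2) / norm (a - b)) * g\<^sup>2"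
      by (simp only: C_def g_def power_mult_distrib mult.assoc)
    show "norm (bessel_ker \<mu> a b) \<le> C * (1 / Gamma (\<mu> + 1))\<^sup>2"
    proof (cases "a = b")
      case True
      have "norm (bessel_ker \<mu> a b) \<le> norm (phi \<mu> a) * (norm (phi (\<mu> + 1) a) / 2 + norm a * norm (phi (\<mu> + 2) a) / 8)
            + norm (phi (\<mu> + 1) a) / 4 * (norm a * norm (phi (\<mu> + 1) a) / 2)"
        unfolding bessel_ker_def psi_def if_P[OF True]
        by (intro order_trans[OF norm_triangle_ineq] add_mono order_trans[OF norm_mult_ineq] mult_left_mono
             order_trans[OF norm_triangle_ineq4] mult_mono) (simp_all add: norm_divide norm_mult)
      also have "\<dots> \<le> g * (g / 2 + norm a * g / 8) + g / 4 * (norm a * g / 2)"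
        by (intro add_mono mult_mono divide_right_mono mult_left_mono P) (use g in auto)
      also have "\<dots> = C * (1 / Gamma (\<mu> + 1))\<^sup>2"
        unfolding C if_P[OF True] by (simp add: algebra_simps power2_eq_square)
      finally show ?thesis .
    next
      case False
      have "norm (phi \<mu> b * psi \<mu> a - phi \<mu> a * psi \<mu> b)
          \<le> norm (phi \<mu> b) * (norm a * norm (phi (\<mu> + 1) a) / 2) + norm (phi \<mu> a) * (norm b * norm (phi (\<mu> + 1) b) / 2)"
        by (intro order_trans[OF norm_triangle_ineq4]) (simp add: psi_def norm_mult norm_divide)
      also have "\<dots> \<le> g * (norm a * g / 2) + g * (norm b * g / 2)"
        by (intro add_mono mult_mono divide_right_mono mult_left_mono P) (use g in auto)
      also have "\<dots> = (norm a / 2 + norm b / 2) * g\<^sup>2"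
        by (simp add: algebra_simps power2_eq_square)
      finally show ?thesis
        unfolding C using False by (simp add: bessel_ker_def norm_divide divide_right_mono)
    qed
  qed
qed

text \<open>
  Each step \<open>\<nu> \<leadsto> \<nu> + 2\<close> multiplies the Gamma value by at least \<open>N + 1\<close>.  The comparison starts at \<open>\<nu> + 3\<close>, because
  \<open>\<nu> + 1\<close> may be arbitrarily close to 0.
\<close>

lemma Gamma_ge_fact:
  assumes "\<nu> > -1"
  shows "fact N * Gamma (\<nu> + 3) \<le> Gamma (\<nu> + 2 * real (Suc N) + 1)"
proof (induction N)
  case (Suc N)
  let ?x = "\<nu> + 2 * real (Suc N) + 1"
  have step: "Gamma (?x + 1 + 1) = (?x + 1) * (?x * Gamma ?x)"
    using assms by (subst Gamma_plus1, force simp: nonpos_Ints_def, subst Gamma_plus1) (auto simp: nonpos_Ints_def)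
  have "fact (Suc N) * Gamma (\<nu> + 3) = (real N + 1) * (1 * (fact N * Gamma (\<nu> + 3)))"
    by (simp add: algebra_simps)
  also have "\<dots> \<le> (?x + 1) * (?x * Gamma ?x)"
    using assms by (intro mult_mono Suc mult_nonneg_nonneg less_imp_le[OF Gamma_real_pos]) auto
  also have "\<dots> = Gamma (?x + 1 + 1)" by (rule step[symmetric])
  finally show ?case by (simp add: algebra_simps)
qed (simp add: add_ac)

lemma power_over_Gamma_tendsto_0:
  assumes "\<nu> > -1" "x \<ge> 0"
  shows "(\<lambda>N. x ^ N / Gamma (\<nu> + 2 * real N + 1)) \<longlonglongrightarrow> 0"
proof -
  have "(\<lambda>N. x ^ N /\<^sub>R fact N * (x / Gamma (\<nu> + 3))) \<longlonglongrightarrow> 0 * (x / Gamma (\<nu> + 3))"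
    by (intro tendsto_mult_right summable_LIMSEQ_zero sums_summable[OF exp_converges])
  then have lim: "(\<lambda>N. x ^ Suc N / (fact N * Gamma (\<nu> + 3))) \<longlonglongrightarrow> 0"
    by (simp add: field_simps)
  have "Gamma (\<nu> + 2 * real (Suc N) + 1) \<ge> fact N * Gamma (\<nu> + 3)" "fact N * Gamma (\<nu> + 3) > 0" for N
    using Gamma_ge_fact[OF assms(1)] assms by (auto intro!: mult_pos_pos Gamma_real_pos)
  then have "(\<lambda>N. x ^ Suc N / Gamma (\<nu> + 2 * real (Suc N) + 1)) \<longlonglongrightarrow> 0"
    using assms
    by (intro tendsto_sandwich[OF _ _ tendsto_const lim] always_eventually allI divide_left_mono
          divide_nonneg_nonneg mult_pos_pos) (auto intro: less_le_trans less_imp_le)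
  then show ?thesis by (rule LIMSEQ_imp_Suc)
qed

theorem bessel_ker_sums:
  fixes a b :: "'a::{real_normed_field,banach}"
  assumes "\<nu> > -1"
  shows "(\<lambda>j. of_real ((\<nu> + 1) / 2 + real j) * ker_feature \<nu> j a * ker_feature \<nu> j b) sums bessel_ker \<nu> a b"
proof -
  obtain C where C: "\<And>\<mu>. \<mu> \<ge> 0 \<Longrightarrow> norm (bessel_ker \<mu> a b) \<le> C * (1 / Gamma (\<mu> + 1))\<^sup>2"
    using bessel_ker_bound[of a b] by blast
  define x where "x = 1 + norm (a * b / 16)"
  have x: "x \<ge> 1" by (simp add: x_def)
  let ?R = "\<lambda>N. (a * b / 16) ^ N * bessel_ker (\<nu> + 2 * real N) a b"
  have "norm (?R N) \<le> \<bar>C\<bar> * (x ^ N / Gamma (\<nu> + 2 * real N + 1))\<^sup>2" if "N \<ge> 1" for N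
  proof -
    have "norm (a * b / 16) ^ N \<le> x ^ N" by (intro power_mono) (auto simp: x_def)
    also have "\<dots> \<le> (x ^ N)\<^sup>2" using x by (simp add: power2_eq_square)
    finally have "norm (?R N) \<le> (x ^ N)\<^sup>2 * (\<bar>C\<bar> * (1 / Gamma (\<nu> + 2 * real N + 1))\<^sup>2)"
      unfolding norm_mult norm_power using that assms
      by (intro mult_mono order_trans[OF C] mult_right_mono) auto
    then show ?thesis unfolding power_divide by (simp only: times_divide_eq_right mult_ac one_power2 mult_1_right mult_1)
  qed
  moreover have "(\<lambda>N. \<bar>C\<bar> * (x ^ N / Gamma (\<nu> + 2 * real N + 1))\<^sup>2) \<longlonglongrightarrow> \<bar>C\<bar> * 0\<^sup>2"
    using x assms by (intro tendsto_intros power_over_Gamma_tendsto_0) auto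
  ultimately have "?R \<longlonglongrightarrow> 0"
    by (intro Lim_null_comparison[of ?R]) (auto intro: eventually_sequentiallyI[of 1])
  then have "(\<lambda>N. bessel_ker \<nu> a b - ?R N) \<longlonglongrightarrow> bessel_ker \<nu> a b - 0"
    by (intro tendsto_intros)
  moreover have "(\<lambda>N. bessel_ker \<nu> a b - ?R N)
      = (\<lambda>N. \<Sum>j<N. of_real ((\<nu> + 1) / 2 + real j) * ker_feature \<nu> j a * ker_feature \<nu> j b)"
  proof
    fix N
    show "bessel_ker \<nu> a b - ?R N
        = (\<Sum>j<N. of_real ((\<nu> + 1) / 2 + real j) * ker_feature \<nu> j a * ker_feature \<nu> j b)"
      by (subst bessel_ker_partial_sum[OF assms, of a b N]) (rule add_diff_cancel_right')
  qed
  ultimately show ?thesis by (simp add: sums_def)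
qed

lemma psi_of_real: "\<nu> > -1 \<Longrightarrow> psi \<nu> (of_real x) = (of_real (psi \<nu> x) :: 'a::{real_normed_field,banach})"
  by (simp add: psi_def phi_of_real)

lemma psi_cnj: "\<nu> > -1 \<Longrightarrow> psi \<nu> (cnj z) = cnj (psi \<nu> z)"
  by (simp add: psi_def phi_cnj)

lemma bessel_ker_of_real:
  "\<nu> > -1 \<Longrightarrow> bessel_ker \<nu> (of_real a) (of_real b) = (of_real (bessel_ker \<nu> a b) :: 'a::{real_normed_field,banach})"
  by (simp add: bessel_ker_def psi_of_real phi_of_real)

lemma bessel_ker_cnj: "\<nu> > -1 \<Longrightarrow> bessel_ker \<nu> (cnj a) (cnj b) = cnj (bessel_ker \<nu> a b)"
  by (simp add: bessel_ker_def psi_cnj phi_cnj)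

lemma ker_feature_cnj: "\<nu> > -1 \<Longrightarrow> ker_feature \<nu> j (cnj z) = cnj (ker_feature \<nu> j z)"
  by (simp add: ker_feature_def phi_cnj)

text \<open>
  If all features vanished at \<open>z \<noteq> 0\<close>, the recurrence would let \<open>phi (\<nu> + 1 + n)\<close> vanish at \<open>z\<close> for all \<open>n\<close>.  These are,
  up to factors, all derivatives of \<open>phi (\<nu> + 1)\<close> at \<open>z\<close>, but that function is not identically zero.
\<close>

lemma ker_feature_nonzero:
  fixes z :: complex
  assumes "\<nu> > -1"
  obtains j where "ker_feature \<nu> j z \<noteq> 0"
proof (rule ccontr)
  assume "\<not> thesis"
  with that have zero: "ker_feature \<nu> j z = 0" for j by blast
  show False
  proof (cases "z = 0")
    case True
    with zero[of 0] assms show False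
      using phi_0_nonzero[of "\<nu> + 1", where 'a = complex] by (simp add: ker_feature_def)
  next
    case False
    with zero have even: "phi (\<nu> + 1 + 2 * real j) z = 0" for j
      by (simp add: ker_feature_def)
    have odd: "phi (\<nu> + 2 + 2 * real j) z = 0" for j
    proof -
      have "phi (\<nu> + 1 + 2 * real j) z
          = of_real (\<nu> + 2 + 2 * real j) * phi (\<nu> + 2 + 2 * real j) z - z / 4 * phi (\<nu> + 1 + 2 * real (Suc j)) z"
        using phi_recurrence[of "\<nu> + 1 + 2 * real j" z] assms by (simp add: add_ac)
      moreover have "complex_of_real (\<nu> + 2 + 2 * real j) \<noteq> 0"
        using assms by (subst of_real_eq_0_iff) linarith
      ultimately show ?thesis
        unfolding even by simp
    qed
    have all: "phi (\<nu> + 1 + real n) z = 0" for n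
      using even[of "n div 2"] odd[of "n div 2"] by (cases "even n") (auto elim!: evenE oddE simp: add_ac)
    have D: "(deriv ^^ n) (phi (\<nu> + 1)) = (\<lambda>w. (-1/4) ^ n * phi (\<nu> + 1 + real n) (w::complex))" for n
    proof (induction n)
      case (Suc n)
      have "((\<lambda>w. (-1/4) ^ n * phi (\<nu> + 1 + real n) w) has_field_derivative
              (-1/4) ^ Suc n * phi (\<nu> + 1 + real (Suc n)) w) (at w)" for w :: complex
        using assms by (auto intro!: derivative_eq_intros simp: add_ac)
      then show ?case by (auto simp: Suc intro: DERIV_imp_deriv)
    qed simp
    have "phi (\<nu> + 1) (0::complex) = 0"
    proof (rule holomorphic_fun_eq_0_on_connected[of "phi (\<nu> + 1)" UNIV z])
      show "phi (\<nu> + 1) holomorphic_on (UNIV :: complex set)"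
        using phi_has_derivative[of "\<nu> + 1", where 'a = complex] assms
        by (intro holomorphic_onI) (auto simp: field_differentiable_def intro: has_field_derivative_at_within)
    qed (auto simp: D all)
    with assms show False
      using phi_0_nonzero[of "\<nu> + 1", where 'a = complex] by simp
  qed
qed

lemma bessel_ker_cnj_pos:
  assumes "\<nu> > -1"
  shows "Re (bessel_ker \<nu> z (cnj z)) > 0"
proof -
  obtain j where j: "ker_feature \<nu> j z \<noteq> 0" using ker_feature_nonzero[OF assms] by blast
  have "Re (of_real ((\<nu> + 1) / 2 + real j) * ker_feature \<nu> j z * ker_feature \<nu> j (cnj z))
      = ((\<nu> + 1) / 2 + real j) * (cmod (ker_feature \<nu> j z))\<^sup>2" for j
    unfolding ker_feature_cnj[OF assms] mult.assoc complex_norm_square[symmetric] by simp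
  with sums_Re[OF bessel_ker_sums[OF assms, of z "cnj z"]]
  have S: "(\<lambda>j. ((\<nu> + 1) / 2 + real j) * (cmod (ker_feature \<nu> j z))\<^sup>2) sums Re (bessel_ker \<nu> z (cnj z))"
    by (simp del: Re_complex_of_real)
  have w: "(\<nu> + 1) / 2 + real j > 0" for j using assms by (simp add: add_pos_nonneg)
  have "0 < (\<Sum>j. ((\<nu> + 1) / 2 + real j) * (cmod (ker_feature \<nu> j z))\<^sup>2)"
    by (rule suminf_pos2[OF sums_summable[OF S], of j])
       (use w j in \<open>auto intro!: mult_nonneg_nonneg mult_pos_pos less_imp_le[OF w]\<close>)
  with S show ?thesis by (simp add: sums_iff)
qed

lemma bessel_ker_diag_pos:
  fixes x :: real
  assumes "\<nu> > -1"
  shows "bessel_ker \<nu> x x > 0"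
  using bessel_ker_cnj_pos[OF assms, of "of_real x"] bessel_ker_of_real[OF assms, of x x, where 'a = complex]
  by simp

text \<open>
  The squared weighted norm of the feature sequence of \<open>z\<close> minus its orthogonal projection to the span of the
  feature sequences of the points of \<open>T\<close> is nonnegative.
\<close>

theorem bessel_ker_Bessel_inequality:
  fixes T :: "real set" and z :: complex
  assumes "\<nu> > -1" "finite T"
    and orth: "\<And>s t. s \<in> T \<Longrightarrow> t \<in> T \<Longrightarrow> s \<noteq> t \<Longrightarrow> bessel_ker \<nu> s t = 0"
  shows "(\<Sum>t\<in>T. (cmod (bessel_ker \<nu> (of_real t) z))\<^sup>2 / bessel_ker \<nu> t t) \<le> Re (bessel_ker \<nu> z (cnj z))"
proof -
  define K where "K = (bessel_ker \<nu> :: complex \<Rightarrow> _)"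
  define u where "u = (\<lambda>j (z::complex). ker_feature \<nu> j z)"
  define w where "w = (\<lambda>j. complex_of_real ((\<nu> + 1) / 2 + real j))"
  define d where "d = (\<lambda>t. K (of_real t) z / of_real (bessel_ker \<nu> t t))"
  define v where "v = (\<lambda>j. u j z - (\<Sum>t\<in>T. d t * u j (of_real t)))"
  have S: "(\<lambda>j. w j * u j a * u j b) sums K a b" for a b
    unfolding w_def u_def K_def by (rule bessel_ker_sums[OF assms(1)])
  have u_cnj: "cnj (u j a) = u j (cnj a)" for j a
    by (simp add: u_def ker_feature_cnj[OF assms(1)])
  have K_cnj: "cnj (K (of_real t) a) = K (of_real t) (cnj a)" for t a
    using bessel_ker_cnj[OF assms(1), of "of_real t" a] by (simp add: K_def)
  have K_real: "K (of_real s) (of_real t) = (if s = t then of_real (bessel_ker \<nu> t t) else 0)"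
    if "s \<in> T" "t \<in> T" for s t
    using bessel_ker_of_real[OF assms(1), of s t, where 'a = complex] orth[OF that] by (auto simp: K_def)
  have Kpos: "bessel_ker \<nu> t t > 0" for t :: real by (rule bessel_ker_diag_pos[OF assms(1)])

  have v_cnj: "cnj (v j) = u j (cnj z) - (\<Sum>t\<in>T. cnj (d t) * u j (of_real t))" for j
    by (simp add: v_def u_cnj)
  \<comment> \<open>\<open>v\<close> is the feature sequence minus its projection; its squared norm is expanded term by term.\<close>
  have expand: "w j * v j * cnj (v j)
      = w j * u j z * u j (cnj z) - (\<Sum>s\<in>T. cnj (d s) * (w j * u j z * u j (of_real s)))
        - (\<Sum>t\<in>T. d t * (w j * u j (of_real t) * u j (cnj z)))
        + (\<Sum>t\<in>T. \<Sum>s\<in>T. d t * cnj (d s) * (w j * u j (of_real t) * u j (of_real s)))" for j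
    unfolding v_cnj unfolding v_def
    by (simp add: algebra_simps sum_distrib_left sum_distrib_right)
  have sums: "(\<lambda>j. w j * v j * cnj (v j)) sums (K z (cnj z) - (\<Sum>s\<in>T. cnj (d s) * K z (of_real s))
      - (\<Sum>t\<in>T. d t * K (of_real t) (cnj z)) + (\<Sum>t\<in>T. \<Sum>s\<in>T. d t * cnj (d s) * K (of_real t) (of_real s)))"
    unfolding expand by (intro sums_add sums_diff sums_sum sums_mult S)
  have d_K: "cnj (d t) * K z (of_real t) = of_real ((cmod (K (of_real t) z))\<^sup>2 / bessel_ker \<nu> t t)"
    "d t * K (of_real t) (cnj z) = of_real ((cmod (K (of_real t) z))\<^sup>2 / bessel_ker \<nu> t t)"
    "d t * cnj (d t) * of_real (bessel_ker \<nu> t t) = of_real ((cmod (K (of_real t) z))\<^sup>2 / bessel_ker \<nu> t t)" for t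
  proof -
    have comm: "K z (of_real t) = K (of_real t) z"
      by (simp add: K_def bessel_ker_commute)
    show "cnj (d t) * K z (of_real t) = of_real ((cmod (K (of_real t) z))\<^sup>2 / bessel_ker \<nu> t t)"
      unfolding comm d_def using complex_norm_square[of "K (of_real t) z"] by (simp add: mult.commute)
    show "d t * K (of_real t) (cnj z) = of_real ((cmod (K (of_real t) z))\<^sup>2 / bessel_ker \<nu> t t)"
      unfolding d_def K_cnj[symmetric] using complex_norm_square[of "K (of_real t) z"] by simp
    show "d t * cnj (d t) * of_real (bessel_ker \<nu> t t) = of_real ((cmod (K (of_real t) z))\<^sup>2 / bessel_ker \<nu> t t)"
      unfolding d_def using complex_norm_square[of "K (of_real t) z"] Kpos[of t] by simp
  qed
  have double: "(\<Sum>t\<in>T. \<Sum>s\<in>T. d t * cnj (d s) * K (of_real t) (of_real s))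
      = (\<Sum>t\<in>T. d t * cnj (d t) * of_real (bessel_ker \<nu> t t))"
  proof (rule sum.cong[OF refl])
    fix t assume t: "t \<in> T"
    have "(\<Sum>s\<in>T. d t * cnj (d s) * K (of_real t) (of_real s))
        = (\<Sum>s\<in>T. if s = t then d t * cnj (d t) * of_real (bessel_ker \<nu> t t) else 0)"
      by (rule sum.cong[OF refl]) (use t in \<open>auto simp: K_real\<close>)
    then show "(\<Sum>s\<in>T. d t * cnj (d s) * K (of_real t) (of_real s)) = d t * cnj (d t) * of_real (bessel_ker \<nu> t t)"
      using t assms(2) by simp
  qed
  have "(\<lambda>j. w j * v j * cnj (v j)) sums
      (K z (cnj z) - of_real (\<Sum>t\<in>T. (cmod (K (of_real t) z))\<^sup>2 / bessel_ker \<nu> t t))"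
    using sums unfolding double d_K by simp
  from sums_Re[OF this]
  have "(\<lambda>j. Re (w j * v j * cnj (v j))) sums
      (Re (K z (cnj z)) - (\<Sum>t\<in>T. (cmod (K (of_real t) z))\<^sup>2 / bessel_ker \<nu> t t))"
    by simp
  moreover have "0 \<le> Re (w j * v j * cnj (v j))" for j
    unfolding mult.assoc complex_norm_square[symmetric] w_def using assms(1) by simp
  ultimately have "0 \<le> Re (K z (cnj z)) - (\<Sum>t\<in>T. (cmod (K (of_real t) z))\<^sup>2 / bessel_ker \<nu> t t)"
    by (rule sums_le[OF _ sums_zero, rotated])
  then show ?thesis by (simp add: K_def)
qed

section \<open>Two lemmas on entire functions\<close>

lemma entire_difference_quotient:
  assumes "f holomorphic_on UNIV"
  shows "(\<lambda>z. if z = a then deriv f a else (f z - f a) / (z - a)) holomorphic_on UNIV"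
proof (rule pole_theorem_0[of "\<lambda>z. f z - f a" UNIV a])
  show "(\<lambda>z. f z - f a) holomorphic_on UNIV"
    by (intro holomorphic_intros assms)
  have "f field_differentiable at a"
    by (rule holomorphic_on_imp_differentiable_at[OF assms]) auto
  then have "((\<lambda>z. f z - f a) has_field_derivative deriv f a - 0) (at a)"
    by (intro DERIV_diff DERIV_const) (simp add: DERIV_deriv_iff_field_differentiable)
  then show "(if a = a then deriv f a else (f a - f a) / (a - a)) = deriv (\<lambda>z. f z - f a) a"
    by (simp add: DERIV_imp_deriv)
qed auto

text \<open>
  Near a zero \<open>a\<close> of \<open>g\<close>, the quotient of \<open>f\<close> and \<open>g\<close> equals that of their difference quotients at \<open>a\<close>, which are
  entire, and the denominator does not vanish at \<open>a\<close> since the zero is simple.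
\<close>

lemma entire_quotient:
  fixes f g :: "complex \<Rightarrow> complex"
  assumes f: "f holomorphic_on UNIV" and g: "g holomorphic_on UNIV"
    and zero: "\<And>z. g z = 0 \<Longrightarrow> f z = 0 \<and> deriv g z \<noteq> 0"
  obtains q where "q holomorphic_on UNIV" "\<And>z. f z = g z * q z"
proof
  define q where "q = (\<lambda>z. if g z = 0 then deriv f z / deriv g z else f z / g z)"
  show "f z = g z * q z" for z
    using zero[of z] by (simp add: q_def)
  have "q field_differentiable (at a)" for a
  proof -
    define dq where "dq = (\<lambda>(h :: complex \<Rightarrow> complex) z. if z = a then deriv h a else (h z - h a) / (z - a))"
    have dq: "dq f holomorphic_on UNIV" "dq g holomorphic_on UNIV"
      using entire_difference_quotient[OF f, of a] entire_difference_quotient[OF g, of a]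
      by (simp_all add: dq_def)
    show ?thesis
    proof (cases "g a = 0")
      case True
      define S where "S = {z. dq g z \<noteq> 0}"
      have "open S"
        using open_Collect_neq[OF holomorphic_on_imp_continuous_on[OF dq(2)] continuous_on_const[of _ 0]]
        by (simp add: S_def)
      moreover have a: "a \<in> S" using zero[OF True] by (simp add: S_def dq_def)
      moreover have "(\<lambda>z. dq f z / dq g z) holomorphic_on S"
        using dq by (intro holomorphic_intros) (auto simp: S_def intro: holomorphic_on_subset)
      moreover have "dq f z / dq g z = q z" if "z \<in> S" for z
        using that True zero[OF True] zero[of z] by (auto simp: S_def dq_def q_def split: if_splits)
      ultimately have "q holomorphic_on S" by (metis (no_types, lifting) holomorphic_transform)
      then show ?thesis using \<open>open S\<close> a by (rule holomorphic_on_imp_differentiable_at)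
    next
      case False
      have "open {z. g z \<noteq> 0}"
        using open_Collect_neq[OF holomorphic_on_imp_continuous_on[OF g] continuous_on_const[of _ 0]]
        by simp
      moreover have "(\<lambda>z. f z / g z) holomorphic_on {z. g z \<noteq> 0}"
        using f g by (intro holomorphic_intros) (auto intro: holomorphic_on_subset)
      then have "q holomorphic_on {z. g z \<noteq> 0}"
        by (rule holomorphic_transform) (simp add: q_def)
      ultimately show ?thesis
        using False by (intro holomorphic_on_imp_differentiable_at[of q "{z. g z \<noteq> 0}"]) auto
    qed
  qed
  then show "q holomorphic_on UNIV" by (simp add: holomorphic_on_def field_differentiable_at_within)
qed

text \<open>
  On the circle \<open>\<bar>z - x\<bar> = r\<close>, the assumption says that \<open>E(z) (1 - (z - x)\<^sup>2 / r\<^sup>2)\<close> has nonnegative real part.  By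
  the maximum principle this persists inside, and \<open>r \<rightarrow> \<infinity>\<close> gives \<open>Re E \<ge> 0\<close> in the whole plane, so that
  \<open>1 / (1 + E)\<close> is bounded.
\<close>

lemma Herglotz_entire_constant:
  fixes E :: "complex \<Rightarrow> complex" and x :: real
  assumes E: "E holomorphic_on UNIV"
    and Im_nonneg: "\<And>z. 0 \<le> Im z * Im ((z - of_real x) * E z)"
  obtains c where "\<And>z. E z = c"
proof -
  have Re_nonneg: "0 \<le> Re (E z)" for z
  proof -
    define f where "f = (\<lambda>r w. - (E w * (1 - (w - of_real x)\<^sup>2 / of_real (r\<^sup>2))))"
    have le: "Re (f r z) \<le> 0" if r: "r > cmod (z - of_real x)" for r
    proof (rule maximum_real_frontier[of "f r" "ball (of_real x) r"])
      have r0: "r > 0" by (rule le_less_trans[OF norm_ge_zero r])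
      have "f r holomorphic_on UNIV"
        unfolding f_def using E r0 by (intro holomorphic_intros) auto
      then show "f r holomorphic_on interior (ball (of_real x) r)" "continuous_on (closure (ball (of_real x) r)) (f r)"
        by (auto intro: holomorphic_on_subset holomorphic_on_imp_continuous_on)
      show "z \<in> ball (of_real x) r" using r by (simp add: dist_norm norm_minus_commute)
      fix w assume "w \<in> frontier (ball (complex_of_real x) r)"
      then have w: "cmod (w - of_real x) = r"
        using r0 by (simp add: dist_norm norm_minus_commute)
      define v where "v = w - of_real x"
      have v: "v * cnj v = of_real (r\<^sup>2)" using w by (simp only: v_def[symmetric] complex_norm_square[symmetric])
      \<comment> \<open>On the circle, \<open>1 - v\<^sup>2 / r\<^sup>2 = v (cnj v - v) / r\<^sup>2 = - 2 \<i> (Im v) v / r\<^sup>2\<close>.\<close>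
      have "1 - v\<^sup>2 / of_real (r\<^sup>2) = v * (cnj v - v) / of_real (r\<^sup>2)"
        using r0 v by (simp add: field_simps power2_eq_square)
      also have "cnj v - v = - 2 * \<i> * of_real (Im v)" by (simp add: complex_eq_iff)
      finally have circle: "1 - v\<^sup>2 / of_real (r\<^sup>2) = v * (- 2 * \<i> * of_real (Im v)) / of_real (r\<^sup>2)" .
      have "f r w = 2 * \<i> * of_real (Im v) * (v * E w) / of_real (r\<^sup>2)"
        unfolding f_def v_def[symmetric] circle by (simp add: algebra_simps)
      then have "Re (f r w) = - 2 * (Im v * Im (v * E w)) / r\<^sup>2"
        unfolding Re_divide_of_real by simp
      moreover have "Im v = Im w" by (simp add: v_def)
      ultimately show "Re (f r w) \<le> 0"
        using Im_nonneg[of w] by (simp add: v_def divide_nonpos_nonneg)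
    qed simp
    have "((\<lambda>r. Re (f r z)) \<longlongrightarrow> Re (- (E z * (1 - (z - of_real x)\<^sup>2 * 0)))) at_top"
    proof -
      have "((\<lambda>r::real. inverse (r\<^sup>2)) \<longlongrightarrow> 0) at_top"
        by (intro tendsto_inverse_0_at_top filterlim_pow_at_top filterlim_ident) auto
      then have "((\<lambda>r. complex_of_real (inverse (r\<^sup>2))) \<longlongrightarrow> of_real 0) at_top"
        by (rule tendsto_of_real)
      then show ?thesis
        unfolding f_def divide_inverse of_real_inverse by (intro tendsto_intros) simp
    qed
    then have "Re (- (E z * (1 - (z - of_real x)\<^sup>2 * 0))) \<le> 0"
      by (rule tendsto_upperbound)
         (auto intro: le eventually_mono[OF eventually_gt_at_top[of "cmod (z - of_real x)"]])
    then show ?thesis by simp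
  qed
  have ge: "1 \<le> cmod (1 + E z)" for z
    using Re_nonneg[of z] complex_Re_le_cmod[of "1 + E z"] by simp
  then have nz: "1 + E z \<noteq> 0" for z by (metis norm_zero not_one_le_zero)
  have "(\<lambda>z. inverse (1 + E z)) constant_on UNIV"
  proof (rule Liouville_theorem)
    show "(\<lambda>z. inverse (1 + E z)) holomorphic_on UNIV"
      using E nz by (intro holomorphic_intros) auto
    show "bounded (range (\<lambda>z. inverse (1 + E z)))"
      using le_imp_inverse_le[OF ge] by (intro boundedI[of _ 1]) (auto simp: norm_inverse)
  qed
  then obtain d where "\<And>z. inverse (1 + E z) = d" by (auto simp: constant_on_def)
  then have "E z = inverse d - 1" for z by (metis add_diff_cancel_left' inverse_inverse_eq)
  then show thesis by (rule that)
qed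

section \<open>Boundary functions\<close>

text \<open>
  Since \<open>x J'(x) = \<nu> J(x) - x J\<^bsub>\<nu>+1\<^esub>(x)\<close>, the function \<open>J\<^bsub>\<nu>,H\<^esub>(x)\<close> is \<open>(x / 2) powr \<nu>\<close> times \<open>bdry \<nu> H (x\<^sup>2)\<close>.
\<close>

definition bdry :: "real \<Rightarrow> ereal \<Rightarrow> 'a \<Rightarrow> 'a::{real_normed_field,banach}" where
  "bdry \<nu> H z = (if H = \<infinity> then phi \<nu> z else of_real (real_of_ereal H + \<nu>) * phi \<nu> z - psi \<nu> z)"

text \<open>
  Chosen such that the passage from \<open>(phi, psi)\<close> to \<open>(bdry, cobdry)\<close> preserves the antisymmetric form in the
  numerator of the kernel (\<open>bessel_ker_bdry\<close>).
\<close>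

definition cobdry :: "real \<Rightarrow> ereal \<Rightarrow> 'a \<Rightarrow> 'a::{real_normed_field,banach}" where
  "cobdry \<nu> H z = (if H = \<infinity> then psi \<nu> z else phi \<nu> z)"

definition bdry_zeros :: "real \<Rightarrow> ereal \<Rightarrow> real set" where
  "bdry_zeros \<nu> H = {t. bdry \<nu> H t = 0}"

lemma bessel_ker_bdry:
  "(a - b) * bessel_ker \<nu> a b = cobdry \<nu> H a * bdry \<nu> H b - bdry \<nu> H a * cobdry \<nu> H b"
  unfolding bessel_ker_mult by (simp add: bdry_def cobdry_def algebra_simps)

context
  fixes \<nu> :: real
  assumes nu: "\<nu> > -1"
begin

lemma psi_has_derivative:
  "(psi \<nu> has_field_derivative (phi (\<nu> + 1) z / 2 - z * phi (\<nu> + 2) z / 8)) (at (z::'a::{real_normed_field,banach}))"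
proof -
  have "((\<lambda>z. z * phi (\<nu> + 1) z / 2) has_field_derivative (phi (\<nu> + 1) z / 2 - z * phi (\<nu> + 2) z / 8)) (at z)"
    by (rule derivative_eq_intros refl | use nu in \<open>simp add: add_ac\<close>)+
  then show ?thesis by (simp add: psi_def[abs_def])
qed

lemma bdry_has_derivative:
  fixes z :: "'a::{real_normed_field,banach}"
  obtains f' g' where "(bdry \<nu> H has_field_derivative f') (at z)" "(cobdry \<nu> H has_field_derivative g') (at z)"
    "bessel_ker \<nu> z z = g' * bdry \<nu> H z - f' * cobdry \<nu> H z"
proof (cases "H = \<infinity>")
  case True
  show ?thesis
    by (rule that[of "- phi (\<nu> + 1) z / 4" "phi (\<nu> + 1) z / 2 - z * phi (\<nu> + 2) z / 8"])
       (use phi_has_derivative[OF nu, of z] psi_has_derivative[of z] True in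
        \<open>simp_all add: bdry_def[abs_def] cobdry_def[abs_def] bessel_ker_def algebra_simps\<close>)
next
  case False
  let ?c = "of_real (real_of_ereal H + \<nu>) :: 'a"
  have "((\<lambda>z. ?c * phi \<nu> z - psi \<nu> z) has_field_derivative
           (?c * (- phi (\<nu> + 1) z / 4) - (phi (\<nu> + 1) z / 2 - z * phi (\<nu> + 2) z / 8))) (at z)"
    by (intro DERIV_diff DERIV_cmult phi_has_derivative nu psi_has_derivative)
  then show ?thesis
    by (intro that[of "?c * (- phi (\<nu> + 1) z / 4) - (phi (\<nu> + 1) z / 2 - z * phi (\<nu> + 2) z / 8)" "- phi (\<nu> + 1) z / 4"])
       (use phi_has_derivative[OF nu, of z] False in
        \<open>simp_all add: bdry_def[abs_def] cobdry_def[abs_def] bessel_ker_def algebra_simps\<close>)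
qed

lemma bdry_of_real: "bdry \<nu> H (of_real x) = (of_real (bdry \<nu> H x) :: 'a::{real_normed_field,banach})"
  and cobdry_of_real: "cobdry \<nu> H (of_real x) = (of_real (cobdry \<nu> H x) :: 'a::{real_normed_field,banach})"
  using nu by (simp_all add: bdry_def cobdry_def psi_of_real phi_of_real)

lemma bdry_cnj: "bdry \<nu> H (cnj z) = cnj (bdry \<nu> H z)"
  and cobdry_cnj: "cobdry \<nu> H (cnj z) = cnj (cobdry \<nu> H z)"
  using nu by (simp_all add: bdry_def cobdry_def psi_cnj phi_cnj)

lemma phi_psi_bdry_entire: "phi \<nu> holomorphic_on UNIV" "psi \<nu> holomorphic_on UNIV" "bdry \<nu> H holomorphic_on UNIV"
proof -
  show phi: "phi \<nu> holomorphic_on UNIV" and psi: "psi \<nu> holomorphic_on UNIV"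
    using phi_has_derivative[OF nu] psi_has_derivative
    by (auto simp: holomorphic_on_def field_differentiable_def)
  show "bdry \<nu> H holomorphic_on UNIV"
    unfolding bdry_def[abs_def] using phi psi by (cases "H = \<infinity>") (auto intro!: holomorphic_intros)
qed

lemma bessel_ker_entire: "(\<lambda>z. bessel_ker \<nu> z (b::complex)) holomorphic_on UNIV"
proof (rule pole_theorem_0[of "\<lambda>z. phi \<nu> b * psi \<nu> z - phi \<nu> z * psi \<nu> b" UNIV b])
  show "(\<lambda>z. phi \<nu> b * psi \<nu> z - phi \<nu> z * psi \<nu> b) holomorphic_on UNIV"
    by (intro holomorphic_intros phi_psi_bdry_entire)
  have "((\<lambda>z. phi \<nu> b * psi \<nu> z - phi \<nu> z * psi \<nu> b) has_field_derivative
          (phi \<nu> b * (phi (\<nu> + 1) b / 2 - b * phi (\<nu> + 2) b / 8) - (- phi (\<nu> + 1) b / 4) * psi \<nu> b)) (at b)"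
    by (intro DERIV_diff DERIV_cmult DERIV_cmult_right phi_has_derivative nu psi_has_derivative)
  then show "bessel_ker \<nu> b b = deriv (\<lambda>z. phi \<nu> b * psi \<nu> z - phi \<nu> z * psi \<nu> b) b"
    by (simp add: bessel_ker_def DERIV_imp_deriv)
qed (simp_all add: bessel_ker_mult)

text \<open>
  At a non-real zero \<open>z\<close>, also \<open>cnj z\<close> is a zero, so the numerator of \<open>bessel_ker \<nu> z (cnj z)\<close> vanishes, against
  positivity.
\<close>

lemma bdry_zero_real:
  assumes "bdry \<nu> H (z::complex) = 0"
  shows "Im z = 0"
proof (rule ccontr)
  assume "Im z \<noteq> 0"
  then have "z - cnj z \<noteq> 0" by (simp add: complex_eq_iff)
  moreover have "(z - cnj z) * bessel_ker \<nu> z (cnj z) = 0"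
    unfolding bessel_ker_bdry[of _ _ _ H] by (simp add: bdry_cnj assms)
  ultimately show False using bessel_ker_cnj_pos[OF nu, of z] by simp
qed

text \<open>
  At a zero, the diagonal value of the kernel reduces to \<open>- bdry' * cobdry\<close>, and it is positive.
\<close>

lemma bdry_zero_simple:
  assumes "bdry \<nu> H (z::complex) = 0"
  shows "deriv (bdry \<nu> H) z \<noteq> 0"
proof -
  from bdry_zero_real[OF assms] have z: "z = of_real (Re z)" by (simp add: complex_eq_iff)
  have "bessel_ker \<nu> z z = of_real (bessel_ker \<nu> (Re z) (Re z))"
    by (subst z, subst (2) z, rule bessel_ker_of_real[OF nu])
  then have "bessel_ker \<nu> z z \<noteq> 0" using bessel_ker_diag_pos[OF nu, of "Re z"] by simp
  with assms show ?thesis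
    by (metis bdry_has_derivative[where H = H and z = z] DERIV_imp_deriv mult_zero_left mult_zero_right diff_zero)
qed

lemma bdry_cobdry_not_both_zero:
  fixes x :: real
  shows "bdry \<nu> H x \<noteq> 0 \<or> cobdry \<nu> H x \<noteq> 0"
  using bdry_has_derivative[where H = H and z = x] bessel_ker_diag_pos[OF nu, of x]
  by (metis diff_self less_irrefl mult_zero_right)

lemma bdry_zeros_orthogonal:
  "s \<in> bdry_zeros \<nu> H \<Longrightarrow> t \<in> bdry_zeros \<nu> H \<Longrightarrow> s \<noteq> t \<Longrightarrow> bessel_ker \<nu> s t = 0"
  using bessel_ker_bdry[of s t \<nu> H] by (simp add: bdry_zeros_def)

lemma finite_bdry_zeros: "finite {t \<in> bdry_zeros \<nu> H. \<bar>t\<bar> \<le> R}"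
proof -
  have "finite {z \<in> cball 0 R. bdry \<nu> H (z::complex) = 0}"
  proof (cases "bdry \<nu> H constant_on (UNIV :: complex set)")
    case True
    moreover have "bdry \<nu> H \<i> \<noteq> 0" using bdry_zero_real[of H \<i>] by auto
    ultimately have "bdry \<nu> H z \<noteq> 0" for z :: complex by (metis UNIV_I constant_on_def)
    then show ?thesis by simp
  next
    case False
    then show ?thesis by (intro holomorphic_compact_finite_zeros[of _ UNIV]) (auto simp: phi_psi_bdry_entire)
  qed
  then have "finite (of_real -` {z \<in> cball 0 R. bdry \<nu> H (z::complex) = 0} :: real set)"
    by (rule finite_vimageI) (auto intro: injI)
  then show ?thesis
    by (rule rev_finite_subset) (auto simp: bdry_zeros_def bdry_of_real)
qed

end

section \<open>Growth on the negative axis\<close>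

definition phi_ratio :: "real \<Rightarrow> real \<Rightarrow> real" where
  "phi_ratio \<nu> s = phi (\<nu> + 1) (- s) / phi \<nu> (- s)"

context
  fixes \<nu> :: real
  assumes nu: "\<nu> > -1"
begin

lemma phi_ratio_pos: "s \<ge> 0 \<Longrightarrow> phi_ratio \<nu> s > 0"
  using phi_nonpos_pos[of \<nu> "- s"] phi_nonpos_pos[of "\<nu> + 1" "- s"] nu by (simp add: phi_ratio_def)

lemma phi_ratio_le:
  assumes "s \<ge> 0"
  shows "phi_ratio \<nu> s \<le> 1 / (\<nu> + 1)"
proof -
  have pos: "phi \<nu> (- s) > 0" "phi (\<nu> + 2) (- s) > 0"
    using assms nu by (auto intro: phi_nonpos_pos)
  have "phi \<nu> (- s) = (\<nu> + 1) * phi (\<nu> + 1) (- s) + s / 4 * phi (\<nu> + 2) (- s)"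
    using phi_recurrence[OF nu, of "- s"] by simp
  moreover have "s / 4 * phi (\<nu> + 2) (- s) \<ge> 0" using assms pos by simp
  ultimately have "(\<nu> + 1) * phi (\<nu> + 1) (- s) \<le> phi \<nu> (- s)" by linarith
  then show ?thesis using pos nu by (simp add: phi_ratio_def field_simps)
qed

text \<open>
  Positivity of the kernel on the diagonal is a Turan-type inequality between \<open>phi \<nu>\<close>, \<open>phi (\<nu> + 1)\<close>, \<open>phi (\<nu> + 2)\<close>;
  the recurrence eliminates the last one.
\<close>

lemma phi_ratio_square_le:
  assumes "s > 0"
  shows "(phi_ratio \<nu> s)\<^sup>2 \<le> (4 + 4 * \<bar>\<nu>\<bar> / (\<nu> + 1)) / s"
proof -
  define p q r where "p = phi \<nu> (- s)" and "q = phi (\<nu> + 1) (- s)" and "r = phi (\<nu> + 2) (- s)"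
  have ratio: "phi_ratio \<nu> s = q / p" by (simp add: phi_ratio_def p_def q_def)
  have p: "p > 0" unfolding p_def using assms nu by (intro phi_nonpos_pos) auto
  have rec: "s * r = 4 * p - 4 * (\<nu> + 1) * q"
    using phi_recurrence[OF nu, of "- s"] by (simp add: p_def q_def r_def)
  have "0 < p * (q / 2 + s * r / 8) + q / 4 * (- s * q / 2)"
    using bessel_ker_diag_pos[OF nu, of "- s"] by (simp add: bessel_ker_def psi_def p_def q_def r_def)
  then have "s * q\<^sup>2 < 4 * p\<^sup>2 - 4 * \<nu> * (p * q)"
    unfolding rec by (simp add: field_simps power2_eq_square)
  then have "s * q\<^sup>2 / p\<^sup>2 \<le> (4 * p\<^sup>2 - 4 * \<nu> * (p * q)) / p\<^sup>2"
    using p by (intro divide_right_mono) auto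
  also have "\<dots> = 4 - 4 * \<nu> * phi_ratio \<nu> s"
    unfolding ratio using p by (simp add: field_simps power2_eq_square)
  also have "\<dots> \<le> 4 + 4 * \<bar>\<nu>\<bar> * phi_ratio \<nu> s"
    using phi_ratio_pos[of s] assms mult_right_mono[of "- \<nu>" "\<bar>\<nu>\<bar>" "phi_ratio \<nu> s"] by simp
  also have "\<dots> \<le> 4 + 4 * \<bar>\<nu>\<bar> * (1 / (\<nu> + 1))"
    using phi_ratio_le[of s] assms by (intro add_left_mono mult_left_mono) auto
  finally show ?thesis
    unfolding ratio using assms by (simp add: field_simps power_divide)
qed

lemma phi_ratio_tendsto_0: "(phi_ratio \<nu> \<longlongrightarrow> 0) at_top"
proof -
  let ?C = "4 + 4 * \<bar>\<nu>\<bar> / (\<nu> + 1)"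
  have "((\<lambda>s. ?C / s) \<longlongrightarrow> 0) at_top"
    by (intro tendsto_divide_0[OF tendsto_const] filterlim_at_top_imp_at_infinity filterlim_ident)
  then have "((\<lambda>s. (phi_ratio \<nu> s)\<^sup>2) \<longlongrightarrow> 0) at_top"
    by (rule tendsto_sandwich[OF _ _ tendsto_const, rotated 2])
       (auto intro!: eventually_mono[OF eventually_gt_at_top[of 0]] phi_ratio_square_le)
  then have "((\<lambda>s. sqrt ((phi_ratio \<nu> s)\<^sup>2)) \<longlongrightarrow> sqrt 0) at_top"
    by (rule tendsto_real_sqrt)
  then show ?thesis by (simp add: tendsto_rabs_zero_iff)
qed

end

text \<open>
  The recurrence says \<open>1 / (s * phi_ratio \<nu> s) = (\<nu> + 1) / s + phi_ratio (\<nu> + 1) s / 4\<close>, and the right-hand side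
  tends to 0.
\<close>

lemma times_phi_ratio_at_top:
  assumes nu: "\<nu> > -1"
  shows "filterlim (\<lambda>s. s * phi_ratio \<nu> s) at_top at_top"
proof -
  have eq: "(\<nu> + 1) / s + phi_ratio (\<nu> + 1) s / 4 = inverse (s * phi_ratio \<nu> s)" if "s > 0" for s
  proof -
    define p q r where "p = phi \<nu> (- s)" and "q = phi (\<nu> + 1) (- s)" and "r = phi (\<nu> + 2) (- s)"
    have pos: "p > 0" "q > 0"
      using that nu by (auto simp: p_def q_def intro: phi_nonpos_pos)
    have ratio: "phi_ratio \<nu> s = q / p" "phi_ratio (\<nu> + 1) s = r / q"
      by (simp_all add: phi_ratio_def p_def q_def r_def add.assoc)
    have p: "p = (\<nu> + 1) * q + s / 4 * r"
      using phi_recurrence[OF nu, of "- s"] by (simp add: p_def q_def r_def)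
    have "inverse (s * (q / p)) = p / (s * q)" by simp
    then show ?thesis
      unfolding ratio using pos(2) that by (simp add: p add_divide_distrib)
  qed
  have "((\<lambda>s. (\<nu> + 1) / s + phi_ratio (\<nu> + 1) s / 4) \<longlongrightarrow> 0 + 0 / 4) at_top"
    using nu by (intro tendsto_intros phi_ratio_tendsto_0 tendsto_divide_0[OF tendsto_const]
      filterlim_at_top_imp_at_infinity filterlim_ident) auto
  moreover have "eventually (\<lambda>s. (\<nu> + 1) / s + phi_ratio (\<nu> + 1) s / 4 = inverse (s * phi_ratio \<nu> s)) at_top"
    by (rule eventually_mono[OF eventually_gt_at_top[of 0] eq])
  ultimately have "((\<lambda>s. inverse (s * phi_ratio \<nu> s)) \<longlongrightarrow> 0 + 0 / 4) at_top"
    by (rule Lim_transform_eventually)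
  then have "((\<lambda>s. inverse (s * phi_ratio \<nu> s)) \<longlongrightarrow> 0) at_top" by simp
  then have "filterlim (\<lambda>s. inverse (inverse (s * phi_ratio \<nu> s))) at_top at_top"
    by (rule filterlim_inverse_at_top)
       (auto intro!: eventually_mono[OF eventually_gt_at_top[of 0]] mult_pos_pos phi_ratio_pos nu)
  then show ?thesis by simp
qed

context
  fixes \<nu> :: real
  assumes nu: "\<nu> > -1"
begin

lemma bdry_neg:
  assumes "s \<ge> 0" "H \<noteq> \<infinity>"
  shows "bdry \<nu> H (- s) = phi \<nu> (- s) * (real_of_ereal H + \<nu> + s * phi_ratio \<nu> s / 2)"
  using phi_nonpos_pos[OF nu, of "- s"] assms
  by (simp add: bdry_def psi_def phi_ratio_def field_simps)

lemma bdry_neg_eventually_pos: "eventually (\<lambda>s::real. bdry \<nu> H (- s) > 0) at_top"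
proof (cases "H = \<infinity>")
  case True
  then show ?thesis
    using phi_nonpos_pos[OF nu]
    by (intro eventually_mono[OF eventually_gt_at_top[of 0]]) (auto simp: bdry_def)
next
  case False
  have "eventually (\<lambda>s. s * phi_ratio \<nu> s \<ge> 2 * \<bar>real_of_ereal H + \<nu>\<bar> + 1) at_top"
    using times_phi_ratio_at_top[OF nu] by (simp add: filterlim_at_top)
  then show ?thesis
    using eventually_gt_at_top[of 0]
  proof eventually_elim
    case (elim s)
    have "0 < a + b / 2" if "2 * \<bar>a\<bar> + 1 \<le> b" for a b :: real
      using that by (simp add: abs_if split: if_splits)
    from this[OF elim(1)] have "0 < real_of_ereal H + \<nu> + s * phi_ratio \<nu> s / 2" .
    with elim show ?case
      using bdry_neg[of s H] False phi_nonpos_pos[OF nu, of "- s"] by simp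
  qed
qed

text \<open>
  The quotient rule produces exactly the diagonal of the kernel, so \<open>cobdry / bdry\<close> is strictly increasing
  between poles.
\<close>

lemma cobdry_over_bdry_derivative:
  assumes "bdry \<nu> H (x::real) \<noteq> 0"
  shows "((\<lambda>x. cobdry \<nu> H x / bdry \<nu> H x) has_real_derivative (bessel_ker \<nu> x x / (bdry \<nu> H x)\<^sup>2)) (at x)"
proof -
  obtain f' g' where d: "(bdry \<nu> H has_field_derivative f') (at x)" "(cobdry \<nu> H has_field_derivative g') (at x)"
    and k: "bessel_ker \<nu> x x = g' * bdry \<nu> H x - f' * cobdry \<nu> H x"
    using bdry_has_derivative[OF nu] by metis
  from DERIV_divide[OF d(2,1) assms] show ?thesis
    by (simp add: k power2_eq_square mult_ac)
qed

lemma cobdry_over_bdry_growth: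
  assumes "a < b" "\<And>x. a \<le> x \<Longrightarrow> x \<le> b \<Longrightarrow> bdry \<nu> H (x::real) \<noteq> 0"
    and c: "\<And>x. a \<le> x \<Longrightarrow> x \<le> b \<Longrightarrow> c * (bdry \<nu> H x)\<^sup>2 \<le> bessel_ker \<nu> x x"
  shows "c * (b - a) \<le> cobdry \<nu> H b / bdry \<nu> H b - cobdry \<nu> H a / bdry \<nu> H a"
proof -
  have "\<exists>z. a < z \<and> z < b \<and> cobdry \<nu> H b / bdry \<nu> H b - cobdry \<nu> H a / bdry \<nu> H a
      = (b - a) * (bessel_ker \<nu> z z / (bdry \<nu> H z)\<^sup>2)"
    by (rule MVT2[OF assms(1)]) (use cobdry_over_bdry_derivative assms(2) in blast)
  then obtain z where z: "a < z" "z < b"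
    and eq: "cobdry \<nu> H b / bdry \<nu> H b - cobdry \<nu> H a / bdry \<nu> H a
      = (b - a) * (bessel_ker \<nu> z z / (bdry \<nu> H z)\<^sup>2)" by blast
  have "c \<le> bessel_ker \<nu> z z / (bdry \<nu> H z)\<^sup>2"
    using c[of z] assms(2)[of z] z by (simp add: le_divide_eq)
  then show ?thesis
    unfolding eq using assms(1) by (subst mult.commute, intro mult_left_mono) auto
qed

lemma cobdry_over_bdry_strict_mono:
  assumes "a < b" "\<And>x. a \<le> x \<Longrightarrow> x \<le> b \<Longrightarrow> bdry \<nu> H (x::real) \<noteq> 0"
  shows "cobdry \<nu> H a / bdry \<nu> H a < cobdry \<nu> H b / bdry \<nu> H b"
proof (rule DERIV_pos_imp_increasing[OF assms(1)])
  fix x assume "a \<le> x" "x \<le> b"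
  then have "bdry \<nu> H x \<noteq> 0" by (rule assms(2))
  then show "\<exists>y. ((\<lambda>x. cobdry \<nu> H x / bdry \<nu> H x) has_real_derivative y) (at x) \<and> 0 < y"
    using cobdry_over_bdry_derivative[of H x] bessel_ker_diag_pos[OF nu, of x] by auto
qed

text \<open>
  The assumption says that \<open>m = cobdry / bdry\<close> has derivative at least \<open>c\<close>.  On a half-line without zeros of \<open>bdry\<close>, a
  positive \<open>c\<close> would make \<open>m\<close> tend to \<open>-\<infinity>\<close> linearly at \<open>-\<infinity>\<close>.  For \<open>H < \<infinity>\<close> it is positive far out; for
  \<open>H = \<infinity>\<close>, \<open>m (- s) / s = - phi_ratio \<nu> s / 2\<close> tends to 0.
\<close>

lemma bdry_square_domination_trivial:
  assumes c: "\<And>y::real. bdry \<nu> H y \<noteq> 0 \<Longrightarrow> c * (bdry \<nu> H y)\<^sup>2 \<le> bessel_ker \<nu> y y"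
  shows "c \<le> 0"
proof (rule ccontr)
  assume "\<not> c \<le> 0"
  then have c0: "c > 0" by simp
  from bdry_neg_eventually_pos[of H] obtain s0 :: real where s0: "\<And>s. s \<ge> s0 \<Longrightarrow> bdry \<nu> H (- s) > 0"
    unfolding eventually_at_top_linorder by blast
  have growth: "c * (s - s1) \<le> cobdry \<nu> H (- s1) / bdry \<nu> H (- s1) - cobdry \<nu> H (- s) / bdry \<nu> H (- s)"
    if "s > s1" "\<And>t. t \<ge> s1 \<Longrightarrow> bdry \<nu> H (- t) > 0" for s s1
  proof -
    have "bdry \<nu> H x \<noteq> 0" if "x \<le> - s1" for x
      using \<open>\<And>t. t \<ge> s1 \<Longrightarrow> bdry \<nu> H (- t) > 0\<close>[of "- x"] that by auto
    then show ?thesis using cobdry_over_bdry_growth[of "- s" "- s1" H c] that(1) c by simp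
  qed
  show False
  proof (cases "H = \<infinity>")
    case True
    have "c \<le> phi_ratio \<nu> s / 2" if "s > 0" for s
    proof -
      have "c * (s - 0) \<le> cobdry \<nu> H (- 0) / bdry \<nu> H (- 0) - cobdry \<nu> H (- s) / bdry \<nu> H (- s)"
        using that True phi_nonpos_pos[OF nu] by (intro growth) (auto simp: bdry_def)
      also have "\<dots> = s * (phi_ratio \<nu> s / 2)"
        using True by (simp add: cobdry_def bdry_def psi_def phi_ratio_def)
      finally show ?thesis using that by (simp add: mult.commute)
    qed
    then have "eventually (\<lambda>s. c \<le> phi_ratio \<nu> s / 2) at_top"
      by (auto intro: eventually_mono[OF eventually_gt_at_top[of 0]])
    moreover have "((\<lambda>s. phi_ratio \<nu> s / 2) \<longlongrightarrow> 0 / 2) at_top"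
      by (intro tendsto_intros phi_ratio_tendsto_0 nu) simp
    ultimately have "c \<le> 0 / 2" by (intro tendsto_lowerbound[of "\<lambda>s. phi_ratio \<nu> s / 2"]) auto
    with c0 show False by simp
  next
    case False
    define s1 where "s1 = max s0 0"
    define m where "m = cobdry \<nu> H (- s1) / bdry \<nu> H (- s1)"
    define s where "s = s1 + \<bar>m\<bar> / c + 1"
    have s: "s > s1" using c0 by (simp add: s_def add_nonneg_pos)
    have "c * (s - s1) \<le> m - cobdry \<nu> H (- s) / bdry \<nu> H (- s)"
      unfolding m_def using s by (intro growth s0) (auto simp: s1_def)
    moreover have "cobdry \<nu> H (- s) / bdry \<nu> H (- s) > 0"
      using s s0[of s] phi_nonpos_pos[OF nu, of "- s"] False by (simp add: cobdry_def s1_def)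
    moreover have "c * (s - s1) = \<bar>m\<bar> + c" using c0 by (simp add: s_def field_simps)
    ultimately show False using c0 by linarith
  qed
qed

end

section \<open>Completeness\<close>

context
  fixes \<nu> :: real and H :: ereal
  assumes nu: "\<nu> > -1"
begin

lemma Bessel_inequality:
  fixes z :: complex
  shows "(\<lambda>t. (cmod (bessel_ker \<nu> (of_real t) z))\<^sup>2 / bessel_ker \<nu> t t) summable_on bdry_zeros \<nu> H"
    and "(\<Sum>\<^sub>\<infinity>t\<in>bdry_zeros \<nu> H. (cmod (bessel_ker \<nu> (of_real t) z))\<^sup>2 / bessel_ker \<nu> t t) \<le> Re (bessel_ker \<nu> z (cnj z))"
proof -
  have le: "(\<Sum>t\<in>T. (cmod (bessel_ker \<nu> (of_real t) z))\<^sup>2 / bessel_ker \<nu> t t) \<le> Re (bessel_ker \<nu> z (cnj z))"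
    if "finite T" "T \<subseteq> bdry_zeros \<nu> H" for T
    using that bdry_zeros_orthogonal[OF nu] by (intro bessel_ker_Bessel_inequality nu) blast+
  show summable: "(\<lambda>t. (cmod (bessel_ker \<nu> (of_real t) z))\<^sup>2 / bessel_ker \<nu> t t) summable_on bdry_zeros \<nu> H"
  proof (rule nonneg_bdd_above_summable_on)
    show "bdd_above (sum (\<lambda>t. (cmod (bessel_ker \<nu> (of_real t) z))\<^sup>2 / bessel_ker \<nu> t t)
            ` {F. F \<subseteq> bdry_zeros \<nu> H \<and> finite F})"
      by (rule bdd_aboveI[of _ "Re (bessel_ker \<nu> z (cnj z))"]) (auto intro: le)
  qed (simp add: bessel_ker_diag_pos[OF nu] less_imp_le)
  show "(\<Sum>\<^sub>\<infinity>t\<in>bdry_zeros \<nu> H. (cmod (bessel_ker \<nu> (of_real t) z))\<^sup>2 / bessel_ker \<nu> t t) \<le> Re (bessel_ker \<nu> z (cnj z))"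
    by (rule infsum_le_finite_sums[OF summable le])
qed

lemma Bessel_inequality_real:
  fixes x :: real
  shows "(\<lambda>t. (bessel_ker \<nu> t x)\<^sup>2 / bessel_ker \<nu> t t) summable_on bdry_zeros \<nu> H"
    and "(\<Sum>\<^sub>\<infinity>t\<in>bdry_zeros \<nu> H. (bessel_ker \<nu> t x)\<^sup>2 / bessel_ker \<nu> t t) \<le> bessel_ker \<nu> x x"
  using Bessel_inequality[of "of_real x"] by (simp_all add: bessel_ker_of_real[OF nu])

context
  fixes x :: real
  assumes Fx: "bdry \<nu> H x \<noteq> 0"
begin

text \<open>
  The component of \<open>K(\<cdot>,x)\<close> along \<open>K(t,\<cdot>)\<close>, evaluated at \<open>z\<close>.
\<close>

definition projection_term :: "real \<Rightarrow> complex \<Rightarrow> complex" where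
  "projection_term t z = of_real (bessel_ker \<nu> t x / bessel_ker \<nu> t t) * bessel_ker \<nu> (of_real t) z"

lemma projection_term_entire: "projection_term t holomorphic_on UNIV"
  unfolding projection_term_def bessel_ker_commute[of \<nu> "of_real t"]
  by (intro holomorphic_intros bessel_ker_entire nu)

text \<open>
  A majorant for the Weierstrass test.  For large \<open>t\<close>, \<open>K(t,z)\<close> is comparable to \<open>K(t,x)\<close>, and \<open>\<Sum> K(t,x)\<^sup>2 / K(t,t)\<close>
  converges by Bessel's inequality; the finitely many small \<open>t\<close> are bounded one by one.
\<close>

lemma projection_term_bound:
  obtains M where "M summable_on bdry_zeros \<nu> H"
    "\<And>t z. t \<in> bdry_zeros \<nu> H \<Longrightarrow> z \<in> cball 0 R \<Longrightarrow> norm (projection_term t z) \<le> M t"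
proof (cases "R \<ge> 0")
  case False
  then show ?thesis by (intro that[of "\<lambda>_. 0"]) auto
next
  case R: True
  have bounded: "\<exists>B. \<forall>z\<in>cball 0 R. norm (f z) \<le> B" if "f holomorphic_on UNIV" for f :: "complex \<Rightarrow> complex"
  proof -
    have "continuous_on (cball 0 R) f"
      using that by (auto intro: holomorphic_on_imp_continuous_on holomorphic_on_subset)
    then have "bounded (f ` cball 0 R)"
      by (intro compact_imp_bounded compact_continuous_image) auto
    then show ?thesis by (auto simp: bounded_iff)
  qed
  obtain C where C: "\<And>z::complex. z \<in> cball 0 R \<Longrightarrow> norm (bdry \<nu> H z) \<le> C"
    using bounded[OF phi_psi_bdry_entire(3)[OF nu, of H]] by blast
  obtain B where B: "\<And>t z. z \<in> cball 0 R \<Longrightarrow> norm (projection_term t z) \<le> B t"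
    using bounded[OF projection_term_entire] by metis
  \<comment> \<open>Beyond \<open>r\<close>, \<open>\<bar>t - x\<bar> \<le> 2 \<bar>t\<bar>\<close> and \<open>\<bar>t - z\<bar> \<ge> \<bar>t\<bar> / 2\<close>.\<close>
  define r where "r = 2 * R + \<bar>x\<bar> + 1"
  define M where "M = (\<lambda>t. 4 * C / \<bar>bdry \<nu> H x\<bar> * ((bessel_ker \<nu> t x)\<^sup>2 / bessel_ker \<nu> t t)
                        + (if \<bar>t\<bar> \<le> r then \<bar>B t\<bar> else 0))"
  have C0: "C \<ge> 0" using order_trans[OF norm_ge_zero C[of 0]] R by simp
  have kpos: "bessel_ker \<nu> t t > 0" for t :: real by (rule bessel_ker_diag_pos[OF nu])
  show ?thesis
  proof (rule that[of M])
    show "M summable_on bdry_zeros \<nu> H"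
      unfolding M_def
    proof (intro summable_on_add summable_on_cmult_right Bessel_inequality_real(1) finite_nonzero_values_imp_summable_on)
      show "finite {t \<in> bdry_zeros \<nu> H. (if \<bar>t\<bar> \<le> r then \<bar>B t\<bar> else 0) \<noteq> 0}"
        by (rule finite_subset[OF _ finite_bdry_zeros[OF nu, of H r]]) auto
    qed
    fix t z assume t: "t \<in> bdry_zeros \<nu> H" and z: "z \<in> cball (0::complex) R"
    show "norm (projection_term t z) \<le> M t"
    proof (cases "\<bar>t\<bar> \<le> r")
      case True
      have "norm (projection_term t z) \<le> \<bar>B t\<bar>" using B[OF z, of t] by linarith
      moreover have "0 \<le> 4 * C / \<bar>bdry \<nu> H x\<bar> * ((bessel_ker \<nu> t x)\<^sup>2 / bessel_ker \<nu> t t)"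
        using C0 kpos[of t] by simp
      ultimately show ?thesis using True by (simp add: M_def)
    next
      case False
      let ?K = "bessel_ker \<nu> (of_real t) z"
      have t0: "bdry \<nu> H t = 0" using t by (simp add: bdry_zeros_def)
      have tx: "t \<noteq> x" using False R by (auto simp: r_def)
      have nz: "norm z \<le> R" using z by simp
      have d1: "\<bar>t - x\<bar> \<le> 2 * \<bar>t\<bar>" using False R by (simp add: r_def)
      have d2: "\<bar>t\<bar> / 2 \<le> norm (of_real t - z)"
        using norm_triangle_ineq2[of "of_real t" z] nz False by (simp add: r_def)
      \<comment> \<open>The two kernel values share the factor \<open>cobdry t\<close> in the numerator; compare the rest.\<close>
      have eq_z: "(of_real t - z) * ?K = of_real (cobdry \<nu> H t) * bdry \<nu> H z"
        using bessel_ker_bdry[of "of_real t" z \<nu> H] t0 by (simp add: bdry_of_real[OF nu] cobdry_of_real[OF nu])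
      have eq_x: "(t - x) * bessel_ker \<nu> t x = cobdry \<nu> H t * bdry \<nu> H x"
        using bessel_ker_bdry[of t x \<nu> H] t0 by simp
      have "\<bar>t\<bar> / 2 * norm ?K \<le> norm (of_real t - z) * norm ?K"
        by (intro mult_right_mono d2) auto
      also have "\<dots> = \<bar>cobdry \<nu> H t\<bar> * norm (bdry \<nu> H z)"
        using arg_cong[OF eq_z, of norm] by (simp add: norm_mult)
      also have "\<dots> \<le> \<bar>cobdry \<nu> H t\<bar> * C" by (intro mult_left_mono C z) auto
      also have "\<dots> = \<bar>t - x\<bar> * \<bar>bessel_ker \<nu> t x\<bar> / \<bar>bdry \<nu> H x\<bar> * C"
        using arg_cong[OF eq_x, of abs] Fx by (simp add: abs_mult)
      also have "\<dots> \<le> 2 * \<bar>t\<bar> * \<bar>bessel_ker \<nu> t x\<bar> / \<bar>bdry \<nu> H x\<bar> * C"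
        by (intro mult_right_mono divide_right_mono d1 C0) auto
      finally have "\<bar>t\<bar> * norm ?K \<le> \<bar>t\<bar> * (4 * C / \<bar>bdry \<nu> H x\<bar> * \<bar>bessel_ker \<nu> t x\<bar>)"
        by (simp add: mult_ac)
      moreover have "\<bar>t\<bar> > 0" using False R by (simp add: r_def)
      ultimately have le: "norm ?K \<le> 4 * C / \<bar>bdry \<nu> H x\<bar> * \<bar>bessel_ker \<nu> t x\<bar>"
        by (rule mult_left_le_imp_le)
      have "norm (projection_term t z) = \<bar>bessel_ker \<nu> t x\<bar> / bessel_ker \<nu> t t * norm ?K"
        using kpos[of t] by (simp add: projection_term_def norm_mult norm_divide)
      also have "\<dots> \<le> \<bar>bessel_ker \<nu> t x\<bar> / bessel_ker \<nu> t t * (4 * C / \<bar>bdry \<nu> H x\<bar> * \<bar>bessel_ker \<nu> t x\<bar>)"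
        using kpos[of t] by (intro mult_left_mono le) auto
      also have "\<dots> = 4 * C / \<bar>bdry \<nu> H x\<bar> * (\<bar>bessel_ker \<nu> t x\<bar>\<^sup>2 / bessel_ker \<nu> t t)"
        by (simp only: power2_eq_square times_divide_eq_left times_divide_eq_right divide_divide_eq_left mult_ac)
      also have "\<bar>bessel_ker \<nu> t x\<bar>\<^sup>2 = (bessel_ker \<nu> t x)\<^sup>2" by (rule power2_abs)
      finally show ?thesis using False by (simp add: M_def)
    qed
  qed
qed

lemma projection_term_summable: "(\<lambda>t. projection_term t z) summable_on bdry_zeros \<nu> H"
proof -
  obtain M where M: "M summable_on bdry_zeros \<nu> H"
    "\<And>t w. t \<in> bdry_zeros \<nu> H \<Longrightarrow> w \<in> cball 0 (norm z) \<Longrightarrow> norm (projection_term t w) \<le> M t"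
    using projection_term_bound by blast
  have "(\<lambda>t. norm (projection_term t z)) summable_on bdry_zeros \<nu> H"
    by (rule Infinite_Sum.abs_summable_on_comparison_test'[OF M(1)]) (rule M(2), auto)
  then show ?thesis by (rule abs_summable_summable)
qed

definition residual :: "complex \<Rightarrow> complex" where
  "residual z = bessel_ker \<nu> z (of_real x) - (\<Sum>\<^sub>\<infinity>t\<in>bdry_zeros \<nu> H. projection_term t z)"

lemma residual_entire: "residual holomorphic_on UNIV"
proof -
  let ?S = "\<lambda>z. \<Sum>\<^sub>\<infinity>t\<in>bdry_zeros \<nu> H. projection_term t z"
  have "?S field_differentiable (at a)" for a
  proof -
    obtain M where "M summable_on bdry_zeros \<nu> H"
      "\<And>t w. t \<in> bdry_zeros \<nu> H \<Longrightarrow> w \<in> cball 0 (norm a + 1) \<Longrightarrow> norm (projection_term t w) \<le> M t"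
      using projection_term_bound by blast
    then have lim: "uniform_limit (cball 0 (norm a + 1)) (\<lambda>T z. \<Sum>t\<in>T. projection_term t z) ?S
        (finite_subsets_at_top (bdry_zeros \<nu> H))"
      by (intro Weierstrass_m_test_general) auto
    have ev: "eventually (\<lambda>T. continuous_on (cball 0 (norm a + 1)) (\<lambda>z. \<Sum>t\<in>T. projection_term t z)
        \<and> (\<lambda>z. \<Sum>t\<in>T. projection_term t z) holomorphic_on ball 0 (norm a + 1))
        (finite_subsets_at_top (bdry_zeros \<nu> H))"
    proof (intro always_eventually allI)
      fix T
      have "(\<lambda>z. \<Sum>t\<in>T. projection_term t z) holomorphic_on UNIV"
        by (intro holomorphic_intros projection_term_entire)
      then show "continuous_on (cball 0 (norm a + 1)) (\<lambda>z. \<Sum>t\<in>T. projection_term t z)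
        \<and> (\<lambda>z. \<Sum>t\<in>T. projection_term t z) holomorphic_on ball 0 (norm a + 1)"
        by (auto intro: holomorphic_on_subset holomorphic_on_imp_continuous_on)
    qed
    have "?S holomorphic_on ball 0 (norm a + 1)"
      by (rule holomorphic_uniform_limit[OF ev lim finite_subsets_at_top_neq_bot])
    then show ?thesis
      by (rule holomorphic_on_imp_differentiable_at) auto
  qed
  then have "?S holomorphic_on UNIV"
    by (simp add: holomorphic_on_def field_differentiable_at_within)
  then show ?thesis
    unfolding residual_def[abs_def] by (intro holomorphic_intros bessel_ker_entire nu)
qed

lemma residual_zero:
  assumes "s \<in> bdry_zeros \<nu> H"
  shows "residual (of_real s) = 0"
proof -
  have "(\<Sum>\<^sub>\<infinity>t\<in>bdry_zeros \<nu> H. projection_term t (of_real s)) = (\<Sum>\<^sub>\<infinity>t\<in>{s}. projection_term t (of_real s))"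
  proof (rule infsum_cong_neutral)
    fix t assume "t \<in> bdry_zeros \<nu> H - {s}"
    then show "projection_term t (of_real s) = 0"
      using bdry_zeros_orthogonal[OF nu, of t H s] assms by (simp add: projection_term_def bessel_ker_of_real[OF nu])
  qed (use assms in auto)
  also have "\<dots> = bessel_ker \<nu> (of_real s) (of_real x)"
    using bessel_ker_diag_pos[OF nu, of s] by (simp add: projection_term_def bessel_ker_of_real[OF nu])
  finally show ?thesis by (simp add: residual_def)
qed

text \<open>
  With \<open>m = cobdry / bdry\<close>, the function in question is \<open>m(z) - m(x) - \<Sum> \<rho>\<^sub>t (1 / (t - z) - 1 / (t - x))\<close>, where
  \<open>\<rho>\<^sub>t = cobdry(t)\<^sup>2 / K(t,t)\<close>.  Multiplied by \<open>\<bar>bdry(z)\<bar>\<^sup>2 / Im z\<close>, its imaginary part is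
  \<open>K(z, cnj z) - \<Sum> \<bar>K(t,z)\<bar>\<^sup>2 / K(t,t)\<close>.
\<close>

lemma residual_Herglotz:
  assumes "Im z \<noteq> 0"
  shows "0 \<le> Im z * Im ((z - of_real x) * (residual z / (bdry \<nu> H z * of_real (bdry \<nu> H x))))"
proof -
  define F G where "F = bdry \<nu> H z" and "G = cobdry \<nu> H z"
  define Fx where "Fx = bdry \<nu> H x"
  define Gx where "Gx = cobdry \<nu> H x"
  have F: "F \<noteq> 0" using bdry_zero_real[OF nu] assms unfolding F_def by blast
  have Fx0: "Fx \<noteq> 0" using \<open>bdry \<nu> H x \<noteq> 0\<close> by (simp add: Fx_def)
  define P where "P = (z - of_real x) / (F * of_real Fx)"
  have kpos: "bessel_ker \<nu> t t > 0" for t :: real by (rule bessel_ker_diag_pos[OF nu])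
  have main: "P * bessel_ker \<nu> z (of_real x) = G / F - of_real (Gx / Fx)"
  proof -
    have "P * bessel_ker \<nu> z (of_real x) = (z - of_real x) * bessel_ker \<nu> z (of_real x) / (F * of_real Fx)"
      by (simp add: P_def)
    also have "(z - of_real x) * bessel_ker \<nu> z (of_real x) = G * of_real Fx - F * of_real Gx"
      unfolding bessel_ker_bdry[of _ _ _ H]
      by (simp add: bdry_of_real[OF nu] cobdry_of_real[OF nu] F_def G_def Fx_def Gx_def)
    finally show ?thesis using F Fx0 by (simp add: diff_divide_distrib)
  qed
  have im_term: "Im (P * projection_term t z)
      = Im z / (cmod F)\<^sup>2 * ((cmod (bessel_ker \<nu> (of_real t) z))\<^sup>2 / bessel_ker \<nu> t t)"
    if t: "t \<in> bdry_zeros \<nu> H" for t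
  proof -
    define g k where "g = cobdry \<nu> H t" and "k = bessel_ker \<nu> t t"
    have t0: "bdry \<nu> H t = 0" using t by (simp add: bdry_zeros_def)
    have tx: "t \<noteq> x" using t0 Fx0 by (auto simp: Fx_def)
    have tz: "of_real t - z \<noteq> 0" using assms by (auto simp: complex_eq_iff)
    have Kz: "bessel_ker \<nu> (of_real t) z = of_real g * F / (of_real t - z)"
      using bessel_ker_bdry[of "of_real t" z \<nu> H] t0 tz
      by (simp add: bdry_of_real[OF nu] cobdry_of_real[OF nu] F_def g_def field_simps)
    have Kx: "bessel_ker \<nu> t x = g * Fx / (t - x)"
      using bessel_ker_bdry[of t x \<nu> H] t0 tx by (simp add: Fx_def g_def field_simps)
    have tx': "complex_of_real t - of_real x \<noteq> 0" using tx by simp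
    have k0: "k > 0" using kpos by (simp add: k_def)
    have "P * projection_term t z = of_real (g\<^sup>2 / k) * ((z - of_real x) / ((of_real t - of_real x) * (of_real t - z)))"
      unfolding P_def projection_term_def Kz Kx k_def[symmetric]
      using F Fx0 k0 by (simp add: power2_eq_square mult_ac)
    also have "(z - of_real x) / ((of_real t - of_real x) * (of_real t - z))
        = 1 / (of_real t - z) - of_real (1 / (t - x))"
      using tz tx' by (simp add: divide_simps)
    finally have "P * projection_term t z = of_real (g\<^sup>2 / k) * (1 / (of_real t - z) - of_real (1 / (t - x)))" .
    then have "Im (P * projection_term t z) = g\<^sup>2 / k * Im (1 / (of_real t - z))" by simp
    also have "Im (1 / (of_real t - z)) = Im z / (cmod (of_real t - z))\<^sup>2"
      by (simp add: Im_divide cmod_power2)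
    finally have "Im (P * projection_term t z) = g\<^sup>2 / k * (Im z / (cmod (of_real t - z))\<^sup>2)" .
    moreover have "(cmod (bessel_ker \<nu> (of_real t) z))\<^sup>2 = g\<^sup>2 * (cmod F)\<^sup>2 / (cmod (of_real t - z))\<^sup>2"
      unfolding Kz by (simp add: norm_mult norm_divide power_mult_distrib power_divide)
    ultimately show ?thesis
      using F by (simp add: k_def[symmetric] mult_ac)
  qed
  define S where "S = (\<Sum>\<^sub>\<infinity>t\<in>bdry_zeros \<nu> H. (cmod (bessel_ker \<nu> (of_real t) z))\<^sup>2 / bessel_ker \<nu> t t)"
  have "((\<lambda>t. P * projection_term t z) has_sum P * (\<Sum>\<^sub>\<infinity>t\<in>bdry_zeros \<nu> H. projection_term t z)) (bdry_zeros \<nu> H)"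
    by (intro has_sum_cmult_right has_sum_infsum projection_term_summable)
  from has_sum_Im[OF this]
  have "((\<lambda>t. Im z / (cmod F)\<^sup>2 * ((cmod (bessel_ker \<nu> (of_real t) z))\<^sup>2 / bessel_ker \<nu> t t))
      has_sum Im (P * (\<Sum>\<^sub>\<infinity>t\<in>bdry_zeros \<nu> H. projection_term t z))) (bdry_zeros \<nu> H)"
    by (rule has_sum_cong[THEN iffD1, rotated]) (rule im_term)
  moreover have "((\<lambda>t. Im z / (cmod F)\<^sup>2 * ((cmod (bessel_ker \<nu> (of_real t) z))\<^sup>2 / bessel_ker \<nu> t t))
      has_sum Im z / (cmod F)\<^sup>2 * S) (bdry_zeros \<nu> H)"
    unfolding S_def by (intro has_sum_cmult_right has_sum_infsum Bessel_inequality)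
  ultimately have sum: "Im (P * (\<Sum>\<^sub>\<infinity>t\<in>bdry_zeros \<nu> H. projection_term t z)) = Im z / (cmod F)\<^sup>2 * S"
    by (rule has_sum_unique)
  define k where "k = Re (bessel_ker \<nu> z (cnj z))"
  have ImGF: "Im (G / F) = Im z / (cmod F)\<^sup>2 * k"
  proof -
    have "(z - cnj z) * bessel_ker \<nu> z (cnj z) = G * cnj F - cnj (G * cnj F)"
      using bessel_ker_bdry[of z "cnj z" \<nu> H]
      by (simp add: bdry_cnj[OF nu] cobdry_cnj[OF nu] F_def G_def mult.commute)
    also have "\<dots> = 2 * \<i> * of_real (Im (G * cnj F))" by (simp add: complex_eq_iff)
    also have "z - cnj z = 2 * \<i> * of_real (Im z)" by (simp add: complex_diff_cnj)
    finally have "of_real (Im z) * bessel_ker \<nu> z (cnj z) = of_real (Im (G * cnj F))" by simp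
    then have "Im z * k = Im (G * cnj F)"
      by (auto simp: k_def complex_eq_iff)
    moreover have "G / F = (G * cnj F) / of_real ((cmod F)\<^sup>2)"
      unfolding complex_norm_square using F by simp
    ultimately show ?thesis by (simp only: Im_divide_of_real) (simp only: times_divide_eq_left)
  qed
  have "(z - of_real x) * (residual z / (bdry \<nu> H z * of_real (bdry \<nu> H x))) = P * residual z"
    by (simp add: P_def F_def Fx_def)
  also have "\<dots> = G / F - of_real (Gx / Fx) - P * (\<Sum>\<^sub>\<infinity>t\<in>bdry_zeros \<nu> H. projection_term t z)"
    by (simp only: residual_def right_diff_distrib main)
  finally have Im_eq: "Im ((z - of_real x) * (residual z / (bdry \<nu> H z * of_real (bdry \<nu> H x))))
      = Im z / (cmod F)\<^sup>2 * (k - S)"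
    by (simp only: minus_complex.sel Im_complex_of_real ImGF sum) (simp only: right_diff_distrib diff_0_right)
  have "S \<le> k" unfolding S_def k_def by (rule Bessel_inequality(2))
  then have "0 \<le> (Im z * Im z) / (cmod F)\<^sup>2 * (k - S)"
    by (intro mult_nonneg_nonneg[OF divide_nonneg_nonneg[OF zero_le_square zero_le_power2]]) simp
  then show ?thesis
    unfolding Im_eq by (simp only: times_divide_eq_left times_divide_eq_right mult.assoc)
qed

text \<open>
  The residual divided by \<open>bdry\<close> is entire, because the residual vanishes at the simple zeros of \<open>bdry\<close>, and then
  constant by \<open>Herglotz_entire_constant\<close>.
\<close>

lemma residual_proportional:
  obtains c where "\<And>z. residual z = c * of_real (bdry \<nu> H x) * bdry \<nu> H z"
proof -
  have "residual z = 0 \<and> deriv (bdry \<nu> H) z \<noteq> 0" if "bdry \<nu> H z = 0" for z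
  proof -
    have z: "z = of_real (Re z)" using bdry_zero_real[OF nu that] by (simp add: complex_eq_iff)
    then have "Re z \<in> bdry_zeros \<nu> H"
      using that bdry_of_real[OF nu, of H "Re z", where 'a = complex] by (simp add: bdry_zeros_def)
    then show ?thesis using residual_zero z bdry_zero_simple[OF nu that] by metis
  qed
  with entire_quotient[OF residual_entire phi_psi_bdry_entire(3)[OF nu, of H]]
  obtain q where q: "q holomorphic_on UNIV" "\<And>z. residual z = bdry \<nu> H z * q z" by metis
  have holo: "(\<lambda>z. q z / of_real (bdry \<nu> H x)) holomorphic_on UNIV"
    using Fx by (intro holomorphic_intros q) auto
  have Im_nonneg: "0 \<le> Im z * Im ((z - of_real x) * (q z / of_real (bdry \<nu> H x)))" for z
  proof (cases "Im z = 0")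
    case False
    then have "bdry \<nu> H z \<noteq> 0" using bdry_zero_real[OF nu] by blast
    then show ?thesis using residual_Herglotz[OF False] by (simp add: q(2))
  qed simp
  obtain c where c: "\<And>z. q z / of_real (bdry \<nu> H x) = c"
    by (rule Herglotz_entire_constant[OF holo Im_nonneg]) blast
  have "residual z = c * of_real (bdry \<nu> H x) * bdry \<nu> H z" for z
    unfolding c[of z, symmetric] q(2)[of z] using Fx by simp
  then show ?thesis by (rule that)
qed

lemma residual_of_real:
  shows "(\<lambda>t. bessel_ker \<nu> t x * bessel_ker \<nu> t y / bessel_ker \<nu> t t) summable_on bdry_zeros \<nu> H" (is "?f summable_on _")
    and "residual (of_real y) = of_real (bessel_ker \<nu> x y
      - (\<Sum>\<^sub>\<infinity>t\<in>bdry_zeros \<nu> H. bessel_ker \<nu> t x * bessel_ker \<nu> t y / bessel_ker \<nu> t t))"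
proof -
  have eq: "projection_term t (of_real y) = of_real (?f t)" for t
    by (simp add: projection_term_def bessel_ker_of_real[OF nu])
  from summable_on_Re[OF projection_term_summable[of "of_real y"]]
  show sum: "?f summable_on bdry_zeros \<nu> H" by (simp only: eq Re_complex_of_real)
  have "(\<Sum>\<^sub>\<infinity>t\<in>bdry_zeros \<nu> H. projection_term t (of_real y)) = of_real (\<Sum>\<^sub>\<infinity>t\<in>bdry_zeros \<nu> H. ?f t)"
    unfolding eq by (rule infsumI[OF has_sum_of_real[OF has_sum_infsum[OF sum]]])
  then show "residual (of_real y) = of_real (bessel_ker \<nu> x y - (\<Sum>\<^sub>\<infinity>t\<in>bdry_zeros \<nu> H. ?f t))"
    unfolding residual_def bessel_ker_of_real[OF nu] bessel_ker_commute[of \<nu> y x] by (simp only: of_real_diff)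
qed

end

text \<open>
  The restriction of the residual to real arguments, now as a symmetric function of both points.
\<close>

definition defect :: "real \<Rightarrow> real \<Rightarrow> real" where
  "defect x y = bessel_ker \<nu> x y
      - (\<Sum>\<^sub>\<infinity>t\<in>bdry_zeros \<nu> H. bessel_ker \<nu> t x * bessel_ker \<nu> t y / bessel_ker \<nu> t t)"

lemma defect_commute: "defect x y = defect y x"
proof -
  have "(\<Sum>\<^sub>\<infinity>t\<in>bdry_zeros \<nu> H. bessel_ker \<nu> t x * bessel_ker \<nu> t y / bessel_ker \<nu> t t)
      = (\<Sum>\<^sub>\<infinity>t\<in>bdry_zeros \<nu> H. bessel_ker \<nu> t y * bessel_ker \<nu> t x / bessel_ker \<nu> t t)"
    by (rule infsum_cong) (rule arg_cong2[where f = "(/)", OF mult.commute refl])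
  then show ?thesis
    unfolding defect_def using bessel_ker_commute[of \<nu> x y] by linarith
qed

lemma defect_bounds: "0 \<le> defect x x" "defect x x \<le> bessel_ker \<nu> x x"
proof -
  show "0 \<le> defect x x"
    using Bessel_inequality_real(2)[of x] by (simp add: defect_def power2_eq_square)
  have "0 \<le> (\<Sum>\<^sub>\<infinity>t\<in>bdry_zeros \<nu> H. bessel_ker \<nu> t x * bessel_ker \<nu> t x / bessel_ker \<nu> t t)"
    by (intro infsum_nonneg divide_nonneg_pos bessel_ker_diag_pos nu) auto
  then show "defect x x \<le> bessel_ker \<nu> x x" by (simp add: defect_def)
qed

lemma defect_proportional:
  assumes "bdry \<nu> H x \<noteq> 0"
  obtains c where "\<And>y. defect x y = c * bdry \<nu> H x * bdry \<nu> H y"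
proof -
  obtain c where c: "\<And>z. residual x z = c * of_real (bdry \<nu> H x) * bdry \<nu> H z"
    using residual_proportional[OF assms] by blast
  have "defect x y = Re c * bdry \<nu> H x * bdry \<nu> H y" for y
  proof -
    have "complex_of_real (defect x y) = c * of_real (bdry \<nu> H x * bdry \<nu> H y)"
      using c[of "of_real y"] residual_of_real(2)[OF assms, of y]
      by (simp add: defect_def bdry_of_real[OF nu])
    from arg_cong[OF this, of Re] show ?thesis by simp
  qed
  then show ?thesis by (rule that)
qed

text \<open>
  By symmetry the constant \<open>c\<close> in \<open>defect x y = c * bdry x * bdry y\<close> is the same for all points, so
  \<open>0 \<le> c * (bdry y)\<^sup>2 = defect y y \<le> K(y,y)\<close> for all real \<open>y\<close> off the zeros, which leaves only \<open>c = 0\<close>.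
\<close>

lemma defect_zero:
  assumes x: "bdry \<nu> H x \<noteq> 0"
  shows "defect x y = 0"
proof -
  obtain c where c: "\<And>y. defect x y = c * bdry \<nu> H x * bdry \<nu> H y"
    by (rule defect_proportional[OF x]) blast
  have diag: "defect y y = c * (bdry \<nu> H y)\<^sup>2" if y: "bdry \<nu> H y \<noteq> 0" for y
  proof -
    obtain d where d: "\<And>z. defect y z = d * bdry \<nu> H y * bdry \<nu> H z"
      by (rule defect_proportional[OF y]) blast
    have "c * bdry \<nu> H x * bdry \<nu> H y = d * bdry \<nu> H y * bdry \<nu> H x"
      unfolding c[symmetric] d[symmetric] by (rule defect_commute)
    then have "c = d" using x y by simp
    then show ?thesis by (simp add: d power2_eq_square)
  qed
  have "c \<le> 0"
  proof (rule bdry_square_domination_trivial[OF nu])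
    fix y :: real assume "bdry \<nu> H y \<noteq> 0"
    from diag[OF this] show "c * (bdry \<nu> H y)\<^sup>2 \<le> bessel_ker \<nu> y y"
      using defect_bounds(2)[of y] by (simp only:)
  qed
  moreover have "c \<ge> 0"
    using diag[OF x] defect_bounds(1)[of x] x by (simp add: zero_le_mult_iff)
  ultimately show ?thesis by (simp add: c)
qed

text \<open>
  Completeness: the functions \<open>K(t,\<cdot>)\<close>, for \<open>t\<close> running over the zeros of one boundary function, span the space
  with reproducing kernel \<open>K\<close>.
\<close>

theorem bessel_ker_expansion:
  assumes "bdry \<nu> H x \<noteq> 0"
  shows "((\<lambda>t. bessel_ker \<nu> t x * bessel_ker \<nu> t y / bessel_ker \<nu> t t) has_sum bessel_ker \<nu> x y) (bdry_zeros \<nu> H)"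
proof -
  have "bessel_ker \<nu> x y = (\<Sum>\<^sub>\<infinity>t\<in>bdry_zeros \<nu> H. bessel_ker \<nu> t x * bessel_ker \<nu> t y / bessel_ker \<nu> t t)"
    using defect_zero[OF assms, of y] unfolding defect_def by (rule right_minus_eq[THEN iffD1])
  then show ?thesis
    by (simp only:) (rule has_sum_infsum[OF residual_of_real(1)[OF assms]])
qed

end

section \<open>The zeros of the boundary functions\<close>

context
  fixes \<nu> :: real
  assumes nu: "\<nu> > -1"
begin

text \<open>
  If there were finitely many zeros, the expansion of \<open>bessel_ker \<nu> 0 (- s)\<close> would be a finite sum of terms that are
  \<open>O(phi \<nu> (- s) / s)\<close>, whereas its value is \<open>phi \<nu> 0 * phi (\<nu> + 1) (- s) / 2\<close>.  This bounds \<open>s * phi_ratio \<nu> s\<close>.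
\<close>

lemma infinite_phi_zeros: "infinite (bdry_zeros \<nu> \<infinity>)"
proof
  assume fin: "finite (bdry_zeros \<nu> \<infinity>)"
  define C where "C = (\<Sum>t\<in>bdry_zeros \<nu> \<infinity>. \<bar>bessel_ker \<nu> t 0\<bar> * \<bar>psi \<nu> t\<bar> / bessel_ker \<nu> t t)"
  have p0: "phi \<nu> 0 > (0::real)" by (rule phi_nonpos_pos[OF nu]) simp
  have kpos: "bessel_ker \<nu> t t > 0" for t :: real by (rule bessel_ker_diag_pos[OF nu])
  have bound: "s * phi_ratio \<nu> s \<le> 2 * C / phi \<nu> 0" if s: "s > 0" for s
  proof -
    have ps: "phi \<nu> (- s) > 0" using s by (intro phi_nonpos_pos nu) auto
    have "s * bessel_ker \<nu> 0 (- s) = s * (phi \<nu> 0 * phi (\<nu> + 1) (- s) / 2)"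
      using bessel_ker_mult[of 0 "- s" \<nu>] by (simp add: psi_def)
    then have K0: "bessel_ker \<nu> 0 (- s) = phi \<nu> 0 * phi (\<nu> + 1) (- s) / 2"
      using s by simp
    have "((\<lambda>t. bessel_ker \<nu> t 0 * bessel_ker \<nu> t (- s) / bessel_ker \<nu> t t) has_sum bessel_ker \<nu> 0 (- s))
            (bdry_zeros \<nu> \<infinity>)"
      using p0 by (intro bessel_ker_expansion nu) (simp add: bdry_def)
    then have "bessel_ker \<nu> 0 (- s) = (\<Sum>t\<in>bdry_zeros \<nu> \<infinity>. bessel_ker \<nu> t 0 * bessel_ker \<nu> t (- s) / bessel_ker \<nu> t t)"
      using fin by (simp add: has_sum_finite_iff)
    also have "\<dots> \<le> (\<Sum>t\<in>bdry_zeros \<nu> \<infinity>. \<bar>bessel_ker \<nu> t 0\<bar> * \<bar>psi \<nu> t\<bar> / bessel_ker \<nu> t t * (phi \<nu> (- s) / s))"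
    proof (rule sum_mono)
      fix t assume t: "t \<in> bdry_zeros \<nu> \<infinity>"
      then have t0: "phi \<nu> t = 0" by (simp add: bdry_zeros_def bdry_def)
      then have tpos: "t > 0" using phi_nonpos_pos[OF nu, of t] by (cases "t \<le> 0") auto
      have "(t + s) * \<bar>bessel_ker \<nu> t (- s)\<bar> = \<bar>psi \<nu> t\<bar> * phi \<nu> (- s)"
        using arg_cong[OF bessel_ker_mult[of t "- s" \<nu>], of abs] t0 tpos s ps by (simp add: abs_mult)
      moreover have "s * \<bar>bessel_ker \<nu> t (- s)\<bar> \<le> (t + s) * \<bar>bessel_ker \<nu> t (- s)\<bar>"
        using tpos by (intro mult_right_mono) auto
      ultimately have "\<bar>bessel_ker \<nu> t (- s)\<bar> \<le> \<bar>psi \<nu> t\<bar> * phi \<nu> (- s) / s"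
        using s by (simp add: le_divide_eq mult.commute)
      then have "\<bar>bessel_ker \<nu> t 0\<bar> * \<bar>bessel_ker \<nu> t (- s)\<bar> \<le> \<bar>bessel_ker \<nu> t 0\<bar> * (\<bar>psi \<nu> t\<bar> * phi \<nu> (- s) / s)"
        by (rule mult_left_mono) simp
      then have "bessel_ker \<nu> t 0 * bessel_ker \<nu> t (- s) \<le> \<bar>bessel_ker \<nu> t 0\<bar> * (\<bar>psi \<nu> t\<bar> * phi \<nu> (- s) / s)"
        by (rule order_trans[OF order_trans[OF abs_ge_self eq_refl[OF abs_mult]]])
      then have "bessel_ker \<nu> t 0 * bessel_ker \<nu> t (- s) / bessel_ker \<nu> t t
          \<le> \<bar>bessel_ker \<nu> t 0\<bar> * (\<bar>psi \<nu> t\<bar> * phi \<nu> (- s) / s) / bessel_ker \<nu> t t"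
        using kpos[of t] by (intro divide_right_mono) auto
      then show "bessel_ker \<nu> t 0 * bessel_ker \<nu> t (- s) / bessel_ker \<nu> t t
          \<le> \<bar>bessel_ker \<nu> t 0\<bar> * \<bar>psi \<nu> t\<bar> / bessel_ker \<nu> t t * (phi \<nu> (- s) / s)"
        by (simp add: mult_ac)
    qed
    also have "\<dots> = C * (phi \<nu> (- s) / s)" unfolding C_def by (rule sum_distrib_right[symmetric])
    finally have "phi \<nu> 0 * phi (\<nu> + 1) (- s) / 2 \<le> C * (phi \<nu> (- s) / s)" unfolding K0 .
    then show ?thesis
      using p0 ps s by (simp add: phi_ratio_def field_simps)
  qed
  have "eventually (\<lambda>s. 2 * C / phi \<nu> 0 + 1 \<le> s * phi_ratio \<nu> s) at_top"
    using times_phi_ratio_at_top[OF nu] by (simp add: filterlim_at_top)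
  then have "eventually (\<lambda>s::real. False) at_top"
    using eventually_gt_at_top[of 0]
  proof eventually_elim
    case (elim s)
    then show False using bound[of s] by linarith
  qed
  then show False by simp
qed

text \<open>
  Beyond the last zero of \<open>bdry \<nu> H\<close>, the quotient \<open>phi / bdry\<close> would be strictly increasing, and yet it vanishes at
  infinitely many zeros of \<open>phi\<close>.
\<close>

lemma infinite_pos_bdry_zeros: "infinite {t \<in> bdry_zeros \<nu> H. t > 0}"
proof
  assume fin: "finite {t \<in> bdry_zeros \<nu> H. t > 0}"
  have fin_phi: "finite {t \<in> bdry_zeros \<nu> \<infinity>. \<not> t > L}" for L
  proof (rule finite_subset)
    show "finite {t \<in> bdry_zeros \<nu> \<infinity>. \<bar>t\<bar> \<le> L}" by (rule finite_bdry_zeros[OF nu])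
    show "{t \<in> bdry_zeros \<nu> \<infinity>. \<not> t > L} \<subseteq> {t \<in> bdry_zeros \<nu> \<infinity>. \<bar>t\<bar> \<le> L}"
    proof
      fix t assume t: "t \<in> {t \<in> bdry_zeros \<nu> \<infinity>. \<not> t > L}"
      then have "t > 0"
        using phi_nonpos_pos[OF nu, of t] by (cases "t \<le> 0") (auto simp: bdry_zeros_def bdry_def)
      with t show "t \<in> {t \<in> bdry_zeros \<nu> \<infinity>. \<bar>t\<bar> \<le> L}" by auto
    qed
  qed
  have inf: "infinite {t \<in> bdry_zeros \<nu> \<infinity>. t > L}" for L
  proof
    assume "finite {t \<in> bdry_zeros \<nu> \<infinity>. t > L}"
    with fin_phi[of L] have "finite ({t \<in> bdry_zeros \<nu> \<infinity>. t > L} \<union> {t \<in> bdry_zeros \<nu> \<infinity>. \<not> t > L})" by blast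
    moreover have "\<dots> = bdry_zeros \<nu> \<infinity>" by auto
    ultimately show False using infinite_phi_zeros by simp
  qed
  show False
  proof (cases "H = \<infinity>")
    case True
    with inf[of 0] fin show False by simp
  next
    case False
    define L where "L = Max (insert 0 {t \<in> bdry_zeros \<nu> H. t > 0})"
    have L: "bdry \<nu> H t \<noteq> 0" if "t > L" for t
    proof
      assume "bdry \<nu> H t = 0"
      moreover have "0 \<le> L" using fin by (simp add: L_def)
      ultimately have "t \<in> {t \<in> bdry_zeros \<nu> H. t > 0}" using that by (simp add: bdry_zeros_def)
      then have "t \<le> L" using fin by (simp add: L_def)
      with that show False by simp
    qed
    obtain a where a: "a \<in> {t \<in> bdry_zeros \<nu> \<infinity>. t > L}"
      using infinite_imp_nonempty[OF inf[of L]] by blast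
    obtain b where b: "b \<in> {t \<in> bdry_zeros \<nu> \<infinity>. t > a}"
      using infinite_imp_nonempty[OF inf[of a]] by blast
    have "cobdry \<nu> H a / bdry \<nu> H a < cobdry \<nu> H b / bdry \<nu> H b"
      using a b L by (intro cobdry_over_bdry_strict_mono nu) auto
    then show False
      using a b False by (simp add: cobdry_def bdry_zeros_def bdry_def)
  qed
qed

lemma bdry_zeros_pos:
  assumes "H = \<infinity> \<or> real_of_ereal H + \<nu> > 0" "t \<in> bdry_zeros \<nu> H"
  shows "t > 0"
proof (rule ccontr)
  assume "\<not> t > 0"
  then have t: "phi \<nu> t > 0" "- t \<ge> 0" using phi_nonpos_pos[OF nu, of t] by auto
  have "bdry \<nu> H t > 0"
  proof (cases "H = \<infinity>")
    case True
    with t show ?thesis by (simp add: bdry_def)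
  next
    case False
    have "0 \<le> - t * phi_ratio \<nu> (- t)"
      by (intro mult_nonneg_nonneg t(2) less_imp_le[OF phi_ratio_pos[OF nu t(2)]])
    then have "0 < real_of_ereal H + \<nu> + - t * phi_ratio \<nu> (- t) / 2"
      using assms(1) False by (intro add_pos_nonneg[of "real_of_ereal H + \<nu>"]) auto
    then show ?thesis
      using bdry_neg[OF nu t(2) False] t(1) by (simp only: minus_minus mult_pos_pos)
  qed
  with assms(2) show False by (simp add: bdry_zeros_def)
qed

text \<open>
  On the half-line \<open>x \<le> 0\<close>, \<open>phi\<close> has no zeros, and for \<open>H < \<infinity>\<close> the equation \<open>bdry \<nu> H x = 0\<close> says \<open>psi x / phi x = H + \<nu>\<close>; the quotient is
  strictly increasing there.
\<close>

lemma bdry_zeros_nonpos_unique: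
  assumes "a \<in> bdry_zeros \<nu> H" "b \<in> bdry_zeros \<nu> H" "a \<le> 0" "b \<le> 0"
  shows "a = b"
proof -
  have no: False if ab: "a < b" "b \<le> 0" "a \<in> bdry_zeros \<nu> H" "b \<in> bdry_zeros \<nu> H" for a b
  proof -
    have pos: "phi \<nu> x > 0" if "x \<le> b" for x using that ab by (intro phi_nonpos_pos nu) auto
    have "cobdry \<nu> \<infinity> a / bdry \<nu> \<infinity> a < cobdry \<nu> \<infinity> b / bdry \<nu> \<infinity> b"
      using ab pos by (intro cobdry_over_bdry_strict_mono nu) (auto simp: bdry_def dest: less_imp_neq[symmetric])
    then have less: "psi \<nu> a / phi \<nu> a < psi \<nu> b / phi \<nu> b" by (simp add: cobdry_def bdry_def)
    have "H \<noteq> \<infinity>" using ab pos[of b] by (auto simp: bdry_def bdry_zeros_def)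
    then have "psi \<nu> x = (real_of_ereal H + \<nu>) * phi \<nu> x" if "x \<in> bdry_zeros \<nu> H" for x
      using that by (simp add: bdry_def bdry_zeros_def)
    with less ab pos[of a] pos[of b] show False by simp
  qed
  show ?thesis using no[of a b] no[of b a] assms by (cases a b rule: linorder_cases) auto
qed

lemma bdry_neg_zero_exists:
  assumes "H \<noteq> \<infinity>" "real_of_ereal H + \<nu> < 0"
  obtains s :: real where "s > 0" "bdry \<nu> H (- s) = 0"
proof -
  have cont: "continuous_on A (\<lambda>s. bdry \<nu> H (- s))" for A :: "real set"
  proof (intro continuous_at_imp_continuous_on ballI)
    fix s :: real
    obtain f' where "(bdry \<nu> H has_field_derivative f') (at (- s))"
      using bdry_has_derivative[OF nu] by metis
    then have "isCont (bdry \<nu> H) (- s)" by (rule DERIV_isCont)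
    then show "isCont (\<lambda>s. bdry \<nu> H (- s)) s"
      by (intro isCont_o2[of s uminus "bdry \<nu> H"]) auto
  qed
  have "phi \<nu> 0 > (0::real)" by (rule phi_nonpos_pos[OF nu]) simp
  then have neg: "bdry \<nu> H (- (0::real)) < 0"
    using assms by (simp add: bdry_def psi_def mult_neg_pos)
  from eventually_conj[OF eventually_gt_at_top[of "0::real"] bdry_neg_eventually_pos[OF nu, of H]]
  obtain S :: real where S: "S > 0" "bdry \<nu> H (- S) > 0"
    using eventually_happens'[OF trivial_limit_at_top_linorder] by blast
  have "\<exists>s. 0 \<le> s \<and> s \<le> S \<and> bdry \<nu> H (- s) = 0"
    using neg S by (intro IVT'[of "\<lambda>s. bdry \<nu> H (- s)"] cont) auto
  then obtain s :: real where s: "0 \<le> s" "bdry \<nu> H (- s) = 0" by blast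
  with neg have "s \<noteq> 0" by auto
  with s show ?thesis by (intro that[of s]) auto
qed

text \<open>
  At a common zero both \<open>phi\<close> and \<open>psi\<close> vanish, hence so does the diagonal of the kernel.
\<close>

lemma bdry_zeros_disjoint:
  assumes "H1 \<noteq> - \<infinity>" "H2 \<noteq> - \<infinity>" "H1 \<noteq> H2" "bdry \<nu> H1 (x::real) = 0"
  shows "bdry \<nu> H2 x \<noteq> 0"
proof
  assume zero: "bdry \<nu> H2 x = 0"
  have finite_case: "p = 0 \<and> q = 0" if "(r + \<nu>) * p - q = 0" "(r' + \<nu>) * p - q = 0" "r \<noteq> r'" for p q r r' :: real
  proof -
    have "(r - r') * p = ((r + \<nu>) * p - q) - ((r' + \<nu>) * p - q)" by (simp add: algebra_simps)
    then have "(r - r') * p = 0" using that by simp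
    with that show ?thesis by simp
  qed
  consider "H1 = \<infinity>" | "H2 = \<infinity>" | r r' where "H1 = ereal r" "H2 = ereal r'"
    using assms(1,2) by (cases H1; cases H2) auto
  then have "phi \<nu> x = 0 \<and> psi \<nu> x = 0"
  proof cases
    case 3
    then show ?thesis
      using finite_case[of r "phi \<nu> x" "psi \<nu> x" r'] zero assms(3,4) by (simp add: bdry_def)
  qed (use zero assms(3,4) in \<open>simp_all add: bdry_def\<close>)
  then have "bessel_ker \<nu> x x = 0"
    by (simp add: bessel_ker_def)
  then show False using bessel_ker_diag_pos[OF nu, of x] by simp
qed

end

section \<open>Bessel functions and boundary functions\<close>

lemma bessel_J_I_eq_phi:
  assumes "\<nu> > -1" "x > 0"
  shows "bessel_J \<nu> x = (x / 2) powr \<nu> * phi \<nu> (x\<^sup>2)"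
    and "bessel_I \<nu> x = (x / 2) powr \<nu> * phi \<nu> (- x\<^sup>2)"
proof -
  have pw: "(x / 2) powr (2 * real m + \<nu>) = (x / 2) powr \<nu> * ((1/4) ^ m * (x\<^sup>2) ^ m)" for m
  proof -
    have "(x / 2) powr (2 * real m) = (x / 2) ^ (2 * m)"
      using assms powr_realpow[of "x / 2" "2 * m"] by simp
    also have "\<dots> = ((x / 2)\<^sup>2) ^ m" by (rule power_mult)
    also have "\<dots> = (1/4) ^ m * (x\<^sup>2) ^ m" by (simp add: power_divide)
    finally show ?thesis by (simp add: powr_add)
  qed
  have J: "(- 1) ^ m / (fact m * Gamma (real m + \<nu> + 1)) * (x / 2) powr (2 * real m + \<nu>)
      = (x / 2) powr \<nu> * (phi_coeff \<nu> m * (x\<^sup>2) ^ m)" for m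
  proof -
    have "(- 1 / 4 :: real) ^ m = (- 1) ^ m * (1/4) ^ m"
      by (simp only: power_mult_distrib[symmetric]) simp
    then show ?thesis
      unfolding pw phi_coeff_def by simp
  qed
  have I: "1 / (fact m * Gamma (real m + \<nu> + 1)) * (x / 2) powr (2 * real m + \<nu>)
      = (x / 2) powr \<nu> * (phi_coeff \<nu> m * (- x\<^sup>2) ^ m)" for m
  proof -
    have "(- 1 / 4) ^ m * (- x\<^sup>2) ^ m = (1/4) ^ m * (x\<^sup>2) ^ m"
      by (simp only: power_mult_distrib[symmetric]) simp
    then show ?thesis
      unfolding pw phi_coeff_def by simp
  qed
  show "bessel_J \<nu> x = (x / 2) powr \<nu> * phi \<nu> (x\<^sup>2)"
    unfolding bessel_J_def J using phi_summable[OF assms(1), of "x\<^sup>2"]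
    by (simp add: phi_def suminf_mult)
  show "bessel_I \<nu> x = (x / 2) powr \<nu> * phi \<nu> (- x\<^sup>2)"
    unfolding bessel_I_def I using phi_summable[OF assms(1), of "- x\<^sup>2"]
    by (simp add: phi_def suminf_mult)
qed

lemma bessel_JH_IH_eq_bdry:
  assumes nu: "\<nu> > -1" and x: "x > 0"
  shows "bessel_JH \<nu> H x = (x / 2) powr \<nu> * bdry \<nu> H (x\<^sup>2)"
    and "bessel_IH \<nu> H x = (x / 2) powr \<nu> * bdry \<nu> H (- x\<^sup>2)"
proof -
  have D: "((\<lambda>x. (x / 2) powr \<nu> * phi \<nu> (e * x\<^sup>2)) has_real_derivative
          (x / 2) powr \<nu> * (\<nu> * phi \<nu> (e * x\<^sup>2) - psi \<nu> (e * x\<^sup>2)) / x) (at x)" for e :: real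
  proof -
    have "((\<lambda>x. phi \<nu> (e * x\<^sup>2)) has_real_derivative - phi (\<nu> + 1) (e * x\<^sup>2) / 4 * (e * (2 * x))) (at x)"
      by (rule DERIV_chain2[OF phi_has_derivative[OF nu]]) (auto intro!: derivative_eq_intros)
    moreover have "((\<lambda>x. (x / 2) powr \<nu>) has_real_derivative \<nu> * (x / 2) powr (\<nu> - 1) * (1/2)) (at x)"
      using x by (intro DERIV_chain2[OF has_real_derivative_powr]) (auto intro!: derivative_eq_intros)
    moreover have "(x / 2) powr (\<nu> - 1) = (x / 2) powr \<nu> / (x / 2)"
      using x by (simp add: powr_diff)
    ultimately have "((\<lambda>x. (x / 2) powr \<nu> * phi \<nu> (e * x\<^sup>2)) has_real_derivative
        (\<nu> * ((x / 2) powr \<nu> / (x / 2)) * (1/2)) * phi \<nu> (e * x\<^sup>2)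
        + (- phi (\<nu> + 1) (e * x\<^sup>2) / 4 * (e * (2 * x))) * (x / 2) powr \<nu>) (at x)"
      using DERIV_mult by fastforce
    then show ?thesis
      using x by (elim DERIV_cong) (simp add: psi_def field_simps power2_eq_square)
  qed
  have transfer: "x * deriv f x + h * f x = (x / 2) powr \<nu> * ((h + \<nu>) * phi \<nu> (e * x\<^sup>2) - psi \<nu> (e * x\<^sup>2))"
    if "\<And>x. x > 0 \<Longrightarrow> f x = (x / 2) powr \<nu> * phi \<nu> (e * x\<^sup>2)" for f e h
  proof -
    have "(f has_real_derivative (x / 2) powr \<nu> * (\<nu> * phi \<nu> (e * x\<^sup>2) - psi \<nu> (e * x\<^sup>2)) / x) (at x)"
      by (rule has_field_derivative_transform_within_open[OF D, of "{0<..}"]) (use x that in auto)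
    then have "x * deriv f x = (x / 2) powr \<nu> * (\<nu> * phi \<nu> (e * x\<^sup>2) - psi \<nu> (e * x\<^sup>2))"
      using x by (simp add: DERIV_imp_deriv)
    then show ?thesis
      unfolding that[OF x] by (simp add: algebra_simps)
  qed
  show "bessel_JH \<nu> H x = (x / 2) powr \<nu> * bdry \<nu> H (x\<^sup>2)"
    using transfer[of "bessel_J \<nu>" 1 "real_of_ereal H"] bessel_J_I_eq_phi(1)[OF nu] x
    by (simp add: bessel_JH_def bdry_def)
  show "bessel_IH \<nu> H x = (x / 2) powr \<nu> * bdry \<nu> H (- x\<^sup>2)"
    using transfer[of "bessel_I \<nu>" "-1" "real_of_ereal H"] bessel_J_I_eq_phi(2)[OF nu] x
    by (simp add: bessel_IH_def bdry_def)
qed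


section \<open>Enumerating the zeros\<close>

text \<open>
  The numbering of zeros in the definition of \<open>bessel_zero\<close> is the inverse of the rank function of the set of zeros.
  In an infinite set with finite initial segments, every element has a successor, so all ranks occur.
\<close>

lemma rank_bij_betw:
  fixes Z :: "real set"
  assumes inf: "infinite Z" and fin: "\<And>x. finite {y \<in> Z. y \<le> x}"
  shows "bij_betw (\<lambda>x. card {y \<in> Z. y \<le> x}) Z {1..}"
proof (rule bij_betw_imageI)
  let ?r = "\<lambda>x. card {y \<in> Z. y \<le> x}"
  have mono: "?r x < ?r y" if "x < y" "y \<in> Z" for x y
  proof (rule psubset_card_mono[OF fin])
    have "y \<in> {z \<in> Z. z \<le> y} - {z \<in> Z. z \<le> x}" using that by auto
    moreover have "{z \<in> Z. z \<le> x} \<subseteq> {z \<in> Z. z \<le> y}" using that by auto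
    ultimately show "{z \<in> Z. z \<le> x} \<subset> {z \<in> Z. z \<le> y}" by blast
  qed
  show "inj_on ?r Z"
  proof (rule inj_onI)
    fix x y assume "x \<in> Z" "y \<in> Z" "?r x = ?r y"
    then show "x = y" using mono[of x y] mono[of y x] by (cases x y rule: linorder_cases) auto
  qed
  have next_exists: "\<exists>z\<in>Z. x < z \<and> {y \<in> Z. y \<le> z} = insert z {y \<in> Z. y \<le> x}" for x
  proof -
    have "Z = {y \<in> Z. y \<le> x} \<union> {y \<in> Z. x < y}" by auto
    with inf have "infinite ({y \<in> Z. y \<le> x} \<union> {y \<in> Z. x < y})" by simp
    then have "infinite {y \<in> Z. x < y}" using fin[of x] by blast
    from infinite_imp_nonempty[OF this] obtain w where w: "w \<in> Z" "x < w" by blast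
    define M where "M = {y \<in> Z. x < y \<and> y \<le> w}"
    have M: "finite M" "M \<noteq> {}"
      using w by (auto simp: M_def intro: finite_subset[OF _ fin[of w]])
    from Min_in[OF this] have z: "Min M \<in> Z" "x < Min M" "Min M \<le> w" by (auto simp: M_def)
    have least: "Min M \<le> y" if "y \<in> Z" "x < y" for y
      using M that z by (cases "y \<le> w") (auto simp: M_def)
    show ?thesis
      by (rule bexI[OF _ z(1)]) (use z least in \<open>fastforce\<close>)
  qed
  show "?r ` Z = {1..}"
  proof
    show "?r ` Z \<subseteq> {1..}"
      using fin by (auto simp: Suc_le_eq card_gt_0_iff)
    have "\<exists>x\<in>Z. ?r x = Suc n" for n
    proof (induction n)
      case 0
      obtain w where w: "w \<in> Z" using infinite_imp_nonempty[OF inf] by blast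
      define m where "m = Min {y \<in> Z. y \<le> w}"
      have m: "m \<in> Z" "m \<le> w" "\<And>y. y \<in> Z \<Longrightarrow> y \<le> w \<Longrightarrow> m \<le> y"
        using Min_in[OF fin[of w]] w fin[of w] by (auto simp: m_def)
      then have "{y \<in> Z. y \<le> m} = {m}" by force
      then show ?case using m(1) by (intro bexI[of _ m]) auto
    next
      case (Suc n)
      then obtain x where x: "x \<in> Z" "?r x = Suc n" by blast
      obtain z where z: "z \<in> Z" "x < z" "{y \<in> Z. y \<le> z} = insert z {y \<in> Z. y \<le> x}"
        using next_exists by blast
      then have "?r z = Suc (Suc n)" using fin[of x] x by simp
      with z(1) show ?case by blast
    qed
    note ranks = this
    show "{1..} \<subseteq> ?r ` Z"
    proof
      fix n :: nat assume "n \<in> {1..}"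
      then obtain k where "n = Suc k" by (cases n) auto
      moreover obtain x where "x \<in> Z" "?r x = Suc k" using ranks by blast
      ultimately show "n \<in> ?r ` Z" by (intro image_eqI[of _ _ x]) auto
    qed
  qed
qed

text \<open>
  \<open>J\<close> belongs to positive, \<open>I\<close> to negative arguments of \<open>phi\<close>; the sign of the index 0 accounts for this.
\<close>

definition eigenvalue :: "real \<Rightarrow> ereal \<Rightarrow> nat \<Rightarrow> real" where
  "eigenvalue \<nu> H k = zero_sign k * (bessel_zero \<nu> H k)\<^sup>2"

context
  fixes \<nu> :: real and H :: ereal
  assumes nu: "\<nu> > -1"
begin

lemma bessel_JH_zero_iff: "x > 0 \<Longrightarrow> bessel_JH \<nu> H x = 0 \<longleftrightarrow> x\<^sup>2 \<in> bdry_zeros \<nu> H"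
  and bessel_IH_zero_iff: "x > 0 \<Longrightarrow> bessel_IH \<nu> H x = 0 \<longleftrightarrow> - x\<^sup>2 \<in> bdry_zeros \<nu> H"
  using bessel_JH_IH_eq_bdry[OF nu, of x H] by (simp_all add: bdry_zeros_def)

lemma bessel_zero_bij_betw:
  "bij_betw (bessel_zero \<nu> H) {1..} {x. 0 < x \<and> x\<^sup>2 \<in> bdry_zeros \<nu> H}"
proof -
  define Z where "Z = {x. 0 < x \<and> x\<^sup>2 \<in> bdry_zeros \<nu> H}"
  have Z: "Z = {x. 0 < x \<and> bessel_JH \<nu> H x = 0}"
    using bessel_JH_zero_iff by (auto simp: Z_def)
  have sq: "(\<lambda>x. x\<^sup>2) ` Z = {t \<in> bdry_zeros \<nu> H. t > 0}"
  proof
    show "{t \<in> bdry_zeros \<nu> H. t > 0} \<subseteq> (\<lambda>x. x\<^sup>2) ` Z"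
    proof
      fix t assume "t \<in> {t \<in> bdry_zeros \<nu> H. t > 0}"
      then show "t \<in> (\<lambda>x. x\<^sup>2) ` Z" by (intro image_eqI[of _ _ "sqrt t"]) (auto simp: Z_def)
    qed
  qed (auto simp: Z_def)
  then have inf: "infinite Z" using infinite_pos_bdry_zeros[OF nu, of H] by (metis finite_imageI)
  have fin: "finite {y \<in> Z. y \<le> x}" for x
  proof (rule finite_imageD)
    show "inj_on (\<lambda>x. x\<^sup>2) {y \<in> Z. y \<le> x}"
      by (rule inj_onI) (auto simp: Z_def)
    have "(\<lambda>x. x\<^sup>2) ` {y \<in> Z. y \<le> x} \<subseteq> {t \<in> bdry_zeros \<nu> H. \<bar>t\<bar> \<le> x\<^sup>2}"
      by (auto simp: Z_def intro: power_mono)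
    then show "finite ((\<lambda>x. x\<^sup>2) ` {y \<in> Z. y \<le> x})"
      using finite_bdry_zeros[OF nu] by (rule finite_subset)
  qed
  note bij = rank_bij_betw[OF inf fin]
  have eq: "bessel_zero \<nu> H n = the_inv_into Z (\<lambda>x. card {y \<in> Z. y \<le> x}) n" if "n \<in> {1..}" for n
  proof -
    have "{y. 0 < y \<and> y \<le> x \<and> bessel_JH \<nu> H y = 0} = {y \<in> Z. y \<le> x}" for x
      by (auto simp: Z)
    then show ?thesis
      using that by (simp add: bessel_zero_def the_inv_into_def Z conj_assoc)
  qed
  show ?thesis
    unfolding Z_def[symmetric]
    by (rule bij_betw_cong[THEN iffD2, OF eq bij_betw_the_inv_into[OF bij]])
qed

lemma bessel_zero_0:
  assumes "H \<noteq> - \<infinity>" "H + ereal \<nu> \<le> 0"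
  shows "eigenvalue \<nu> H 0 \<in> bdry_zeros \<nu> H" "eigenvalue \<nu> H 0 \<le> 0"
    and "H + ereal \<nu> < 0 \<Longrightarrow> bessel_zero \<nu> H 0 > 0"
proof -
  have H: "H \<noteq> \<infinity>" using assms by auto
  then obtain h where h: "H = ereal h" using assms(1) by (cases H) auto
  show "eigenvalue \<nu> H 0 \<le> 0" by (simp add: eigenvalue_def zero_sign_def)
  have neg: "bessel_zero \<nu> H 0 > 0 \<and> - (bessel_zero \<nu> H 0)\<^sup>2 \<in> bdry_zeros \<nu> H" if "H + ereal \<nu> < 0"
  proof -
    have "h + \<nu> < 0" using that h by simp
    then obtain s :: real where s: "s > 0" "bdry \<nu> H (- s) = 0"
      using bdry_neg_zero_exists[OF nu H] h by auto
    have "\<exists>!x. 0 < x \<and> bessel_IH \<nu> H x = 0"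
    proof (rule ex1I[of _ "sqrt s"])
      show "0 < sqrt s \<and> bessel_IH \<nu> H (sqrt s) = 0"
        using s by (simp add: bessel_IH_zero_iff bdry_zeros_def)
      fix x assume x: "0 < x \<and> bessel_IH \<nu> H x = 0"
      then have "- x\<^sup>2 \<in> bdry_zeros \<nu> H" using bessel_IH_zero_iff by blast
      moreover have "- s \<in> bdry_zeros \<nu> H" using s by (simp add: bdry_zeros_def)
      ultimately have "- x\<^sup>2 = - s"
        using s(1) by (intro bdry_zeros_nonpos_unique[OF nu, of _ H]) auto
      then show "x = sqrt s" using x by (simp add: real_sqrt_unique)
    qed
    from theI'[OF this] have "0 < bessel_zero \<nu> H 0 \<and> bessel_IH \<nu> H (bessel_zero \<nu> H 0) = 0"
      using that by (simp add: bessel_zero_def)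
    then show ?thesis using bessel_IH_zero_iff by blast
  qed
  then show "H + ereal \<nu> < 0 \<Longrightarrow> bessel_zero \<nu> H 0 > 0" by blast
  show "eigenvalue \<nu> H 0 \<in> bdry_zeros \<nu> H"
  proof (cases "H + ereal \<nu> = 0")
    case True
    then have "eigenvalue \<nu> H 0 = 0" by (simp add: eigenvalue_def bessel_zero_def)
    moreover have "bdry \<nu> H 0 = (0::real)" using True h by (simp add: bdry_def psi_def)
    ultimately show ?thesis by (simp add: bdry_zeros_def)
  next
    case False
    with assms(2) neg show ?thesis by (simp add: eigenvalue_def zero_sign_def)
  qed
qed

lemma eigenvalue_bij_betw:
  assumes "H \<noteq> - \<infinity>"
  shows "bij_betw (eigenvalue \<nu> H) {k. k \<ge> of_bool (H + ereal \<nu> > 0)} (bdry_zeros \<nu> H)"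
proof -
  have "bij_betw (\<lambda>x. x\<^sup>2) {x. 0 < x \<and> x\<^sup>2 \<in> bdry_zeros \<nu> H} {t \<in> bdry_zeros \<nu> H. t > 0}"
    by (rule bij_betw_byWitness[where f' = sqrt]) auto
  from bij_betw_trans[OF bessel_zero_bij_betw this]
  have pos: "bij_betw (eigenvalue \<nu> H) {1..} {t \<in> bdry_zeros \<nu> H. t > 0}"
    by (rule bij_betw_cong[THEN iffD1, rotated]) (simp add: eigenvalue_def zero_sign_def)
  show ?thesis
  proof (cases "H + ereal \<nu> > 0")
    case True
    then have "H = \<infinity> \<or> real_of_ereal H + \<nu> > 0" using assms by (cases H) auto
    then have "{t \<in> bdry_zeros \<nu> H. t > 0} = bdry_zeros \<nu> H"
      using bdry_zeros_pos[OF nu] by blast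
    with pos True show ?thesis by (simp add: atLeast_def)
  next
    case False
    then have le: "H + ereal \<nu> \<le> 0" by simp
    note zero = bessel_zero_0[OF assms le]
    have "bij_betw (eigenvalue \<nu> H) ({0} \<union> {1..}) ({eigenvalue \<nu> H 0} \<union> {t \<in> bdry_zeros \<nu> H. t > 0})"
      using zero(2) by (intro bij_betw_combine pos) auto
    moreover have "{eigenvalue \<nu> H 0} \<union> {t \<in> bdry_zeros \<nu> H. t > 0} = bdry_zeros \<nu> H"
    proof -
      have "t = eigenvalue \<nu> H 0" if "t \<in> bdry_zeros \<nu> H" "\<not> t > 0" for t
        using that zero by (intro bdry_zeros_nonpos_unique[OF nu, of _ H]) auto
      then show ?thesis using zero(1) by auto
    qed
    moreover have "{0::nat} \<union> {1..} = {k. k \<ge> of_bool (H + ereal \<nu> > 0)}"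
      using False by auto
    ultimately show ?thesis by simp
  qed
qed

end

section \<open>The coefficients as normalised kernel values\<close>

text \<open>
  By the differential equation, \<open>z * psi' = z * phi / 2 - \<nu> * psi\<close> and \<open>z * phi' = - psi / 2\<close>; here the recurrence
  plays its role.  At a zero of the boundary function, the right-hand side becomes \<open>phi\<^sup>2 * (z - \<nu>\<^sup>2 + H\<^sup>2)\<close> for
  \<open>H < \<infinity>\<close>, and \<open>psi\<^sup>2\<close> for \<open>H = \<infinity>\<close>, which explains the constants \<open>bessel_const\<close>.
\<close>

lemma bessel_ker_diag_formula:
  fixes z :: "'a::{real_normed_field,banach}"
  assumes "\<nu> > -1"
  shows "2 * z * bessel_ker \<nu> z z = z * (phi \<nu> z)\<^sup>2 - 2 * of_real \<nu> * phi \<nu> z * psi \<nu> z + (psi \<nu> z)\<^sup>2"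
proof -
  have alg: "2 * z * (p * (q / 2 - z * r / 8) + q / 4 * (z * q / 2))
      = z * p\<^sup>2 - 2 * c * p * (z * q / 2) + (z * q / 2)\<^sup>2"
    if "p = (c + 1) * q - z / 4 * r" for p q r c :: 'a
  proof -
    have "z * r = 4 * ((c + 1) * q - p)" using that by (simp add: field_simps)
    then have "2 * z * (p * (q / 2 - z * r / 8) + q / 4 * (z * q / 2))
        = 2 * z * (p * (q / 2 - 4 * ((c + 1) * q - p) / 8) + q / 4 * (z * q / 2))" by simp
    also have "\<dots> = z * p\<^sup>2 - 2 * c * p * (z * q / 2) + (z * q / 2)\<^sup>2"
      by (simp add: field_simps power2_eq_square)
    finally show ?thesis .
  qed
  have "phi \<nu> z = (of_real \<nu> + 1) * phi (\<nu> + 1) z - z / 4 * phi (\<nu> + 2) z"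
    using phi_recurrence[OF assms, of z] by simp
  from alg[OF this] show ?thesis
    by (simp add: bessel_ker_def psi_def)
qed

text \<open>
  The constant \<open>bessel_const\<close> together with the power of \<open>x\<close> that distinguishes \<open>J\<close> or \<open>I\<close> from \<open>phi\<close>.  At the
  zero 0, where both lose their meaning, the value is \<open>1 / sqrt (K(0,0))\<close>.
\<close>

definition coeff_scale :: "real \<Rightarrow> ereal \<Rightarrow> nat \<Rightarrow> real" where
  "coeff_scale \<nu> H n = (if H + ereal \<nu> = 0 \<and> n = 0 then sqrt (2 * (\<nu> + 1)) / phi \<nu> 0
     else bessel_const \<nu> H n * (bessel_zero \<nu> H n / 2) powr \<nu>)"

context
  fixes \<nu> :: real
  assumes nu: "\<nu> > -1"
begin

lemma bessel_zero_pos: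
  assumes "H \<noteq> - \<infinity>" "n \<ge> of_bool (H + ereal \<nu> > 0)" "\<not> (H + ereal \<nu> = 0 \<and> n = 0)"
  shows "bessel_zero \<nu> H n > 0"
proof (cases "n = 0")
  case True
  with assms have "H + ereal \<nu> < 0" by (auto simp: not_less order.order_iff_strict split: if_splits)
  with bessel_zero_0(3)[OF nu assms(1)] True show ?thesis by simp
next
  case False
  then show ?thesis using bij_betwE[OF bessel_zero_bij_betw[OF nu, of H]] by auto
qed

lemma eigenvalue_zero: "bdry \<nu> H (eigenvalue \<nu> H n) = 0"
  if "H \<noteq> - \<infinity>" "n \<ge> of_bool (H + ereal \<nu> > 0)"
  using bij_betwE[OF eigenvalue_bij_betw[OF nu that(1)]] that(2) by (simp add: bdry_zeros_def)

lemma bessel_JI_eq_phi_psi: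
  assumes "bessel_zero \<nu> H n > 0"
  defines "x \<equiv> bessel_zero \<nu> H n"
  shows "bessel_JI n \<nu> x = (x / 2) powr \<nu> * phi \<nu> (eigenvalue \<nu> H n)"
    and "zero_sign n * x * bessel_JI n (\<nu> + 1) x = (x / 2) powr \<nu> * psi \<nu> (eigenvalue \<nu> H n)"
proof -
  have x: "x > 0" using assms by simp
  have pw: "(x / 2) powr (\<nu> + 1) = (x / 2) powr \<nu> * (x / 2)"
    using x by (simp add: powr_add)
  have nu1: "\<nu> + 1 > -1" using nu by simp
  show "bessel_JI n \<nu> x = (x / 2) powr \<nu> * phi \<nu> (eigenvalue \<nu> H n)"
    using bessel_J_I_eq_phi[OF nu x]
    by (cases "n = 0") (simp_all add: bessel_JI_def eigenvalue_def zero_sign_def x_def)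
  show "zero_sign n * x * bessel_JI n (\<nu> + 1) x = (x / 2) powr \<nu> * psi \<nu> (eigenvalue \<nu> H n)"
    using bessel_J_I_eq_phi[OF nu1 x] pw
    by (cases "n = 0") (simp_all add: bessel_JI_def eigenvalue_def zero_sign_def x_def psi_def power2_eq_square)
qed

lemma coeff_scale_square:
  assumes H: "H \<noteq> - \<infinity>" and n: "n \<ge> of_bool (H + ereal \<nu> > 0)"
  shows "(coeff_scale \<nu> H n)\<^sup>2 * bessel_ker \<nu> (eigenvalue \<nu> H n) (eigenvalue \<nu> H n) = 1"
proof (cases "H + ereal \<nu> = 0 \<and> n = 0")
  case True
  then have ev: "eigenvalue \<nu> H n = 0" by (simp add: eigenvalue_def bessel_zero_def)
  have p0: "phi \<nu> 0 > (0::real)" by (rule phi_nonpos_pos[OF nu]) simp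
  have "phi \<nu> 0 = (\<nu> + 1) * phi (\<nu> + 1) (0::real)"
    using phi_recurrence[OF nu, of "0::real"] by simp
  then have "phi (\<nu> + 1) 0 = phi \<nu> (0::real) / (\<nu> + 1)"
    using nu by simp
  then have "bessel_ker \<nu> 0 0 = (phi \<nu> 0)\<^sup>2 / (2 * (\<nu> + 1))"
    by (simp add: bessel_ker_def psi_def power2_eq_square mult_ac)
  then show ?thesis
    unfolding ev using True nu p0 by (simp add: coeff_scale_def power_divide)
next
  case False
  define x t where "x = bessel_zero \<nu> H n" and "t = eigenvalue \<nu> H n"
  define k where "k = bessel_ker \<nu> t t"
  have x: "x > 0" unfolding x_def by (rule bessel_zero_pos[OF H n False])
  have t: "t = zero_sign n * x\<^sup>2" by (simp add: t_def x_def eigenvalue_def)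
  have k: "k > 0" unfolding k_def by (rule bessel_ker_diag_pos[OF nu])
  have zero: "bdry \<nu> H t = 0" unfolding t_def by (rule eigenvalue_zero[OF H n])
  have formula: "2 * t * k = t * (phi \<nu> t)\<^sup>2 - 2 * \<nu> * phi \<nu> t * psi \<nu> t + (psi \<nu> t)\<^sup>2"
    using bessel_ker_diag_formula[OF nu, of t] by (simp add: k_def)
  have scale: "coeff_scale \<nu> H n = bessel_const \<nu> H n * (x / 2) powr \<nu>"
    using False by (auto simp: coeff_scale_def x_def)
  have p: "(x / 2) powr \<nu> > 0" using x by simp
  have "(coeff_scale \<nu> H n)\<^sup>2 * k = 1"
  proof (cases "H = \<infinity>")
    case True
    then have n0: "n \<noteq> 0" using n by auto
    have phi0: "phi \<nu> t = 0" using zero True by (simp add: bdry_def)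
    then have psi: "(psi \<nu> t)\<^sup>2 = 2 * x\<^sup>2 * k" using formula t n0 by (simp add: zero_sign_def)
    have "x * bessel_J (\<nu> + 1) x = (x / 2) powr \<nu> * psi \<nu> t"
      using bessel_JI_eq_phi_psi(2)[of H n] x n0 by (simp add: x_def t_def zero_sign_def bessel_JI_def)
    then have J: "bessel_J (\<nu> + 1) x = (x / 2) powr \<nu> * psi \<nu> t / x" using x by (simp add: field_simps)
    have "bessel_const \<nu> H n = sqrt 2 / \<bar>bessel_J (\<nu> + 1) x\<bar>"
      using True n0 by (simp add: bessel_const_def x_def)
    then have "bessel_const \<nu> H n = sqrt 2 / \<bar>(x / 2) powr \<nu> * psi \<nu> t / x\<bar>"
      unfolding J .
    then have "(coeff_scale \<nu> H n)\<^sup>2 = 2 * x\<^sup>2 / (psi \<nu> t)\<^sup>2"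
      using x p unfolding scale by (simp add: abs_mult power_mult_distrib power_divide)
    then show ?thesis using psi x k by simp
  next
    case fin: False
    define h where "h = real_of_ereal H"
    have psi: "psi \<nu> t = (h + \<nu>) * phi \<nu> t" using zero fin by (simp add: bdry_def h_def)
    have phi0: "phi \<nu> t \<noteq> 0"
      using bdry_cobdry_not_both_zero[OF nu, of H t] zero fin by (simp add: cobdry_def)
    have norm: "2 * t * k = (phi \<nu> t)\<^sup>2 * (t - \<nu>\<^sup>2 + h\<^sup>2)"
      unfolding formula psi by (simp add: algebra_simps power2_eq_square)
    have R: "zero_sign n * (t - \<nu>\<^sup>2 + h\<^sup>2) = 2 * x\<^sup>2 * k / (phi \<nu> t)\<^sup>2"
    proof -
      have "t - \<nu>\<^sup>2 + h\<^sup>2 = 2 * t * k / (phi \<nu> t)\<^sup>2" using norm phi0 by simp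
      then show ?thesis by (simp add: t zero_sign_def)
    qed
    then have Rpos: "zero_sign n * (t - \<nu>\<^sup>2 + h\<^sup>2) > 0" using x k phi0 by simp
    have JI: "bessel_JI n \<nu> x = (x / 2) powr \<nu> * phi \<nu> t"
      using bessel_JI_eq_phi_psi(1)[of H n] x by (simp add: x_def t_def)
    have "(bessel_const \<nu> H n)\<^sup>2 = 2 / (bessel_JI n \<nu> x)\<^sup>2 * (x\<^sup>2 / (zero_sign n * (t - \<nu>\<^sup>2 + h\<^sup>2)))"
    proof (cases "n = 0")
      case True
      then have "x\<^sup>2 + \<nu>\<^sup>2 - h\<^sup>2 = zero_sign n * (t - \<nu>\<^sup>2 + h\<^sup>2)" by (simp add: t zero_sign_def)
      then have "bessel_const \<nu> H n = sqrt 2 / bessel_JI n \<nu> x * (x / sqrt (zero_sign n * (t - \<nu>\<^sup>2 + h\<^sup>2)))"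
        using True by (simp add: bessel_const_def bessel_JI_def Let_def x_def h_def)
      then show ?thesis
        using Rpos by (simp only: power_mult_distrib power_divide real_sqrt_pow2 less_imp_le)
    next
      case False
      then have "x\<^sup>2 - \<nu>\<^sup>2 + h\<^sup>2 = zero_sign n * (t - \<nu>\<^sup>2 + h\<^sup>2)" by (simp add: t zero_sign_def)
      then have "bessel_const \<nu> H n = sqrt 2 / \<bar>bessel_JI n \<nu> x\<bar> * (x / sqrt (zero_sign n * (t - \<nu>\<^sup>2 + h\<^sup>2)))"
        using False fin by (simp add: bessel_const_def bessel_JI_def Let_def x_def h_def)
      then show ?thesis
        using Rpos by (simp only: power_mult_distrib power_divide real_sqrt_pow2 less_imp_le power2_abs)
    qed
    then have "(coeff_scale \<nu> H n)\<^sup>2 = 2 * x\<^sup>2 / ((phi \<nu> t)\<^sup>2 * (2 * x\<^sup>2 * k / (phi \<nu> t)\<^sup>2))"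
      unfolding scale R JI using p by (simp add: power_mult_distrib)
    then show ?thesis using phi0 x k by simp
  qed
  then show ?thesis by (simp add: k_def t_def)
qed

text \<open>
  The bracket in the coefficient is the numerator of the kernel, up to powers of \<open>x / 2\<close> and \<open>y / 2\<close>.  In the corner
  cases one zero is 0; there \<open>psi\<close> vanishes and one product drops out of the bracket.
\<close>

lemma bessel_coeff_scale:
  assumes H: "H1 \<noteq> - \<infinity>" "H2 \<noteq> - \<infinity>" "H1 \<noteq> H2"
    and n: "n \<ge> of_bool (H1 + ereal \<nu> > 0)" and k: "k \<ge> of_bool (H2 + ereal \<nu> > 0)"
  shows "bessel_coeff \<nu> H1 H2 n k = coeff_scale \<nu> H1 n * coeff_scale \<nu> H2 k *
    ((eigenvalue \<nu> H1 n - eigenvalue \<nu> H2 k) * bessel_ker \<nu> (eigenvalue \<nu> H1 n) (eigenvalue \<nu> H2 k))"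
proof -
  define x y where "x = bessel_zero \<nu> H1 n" and "y = bessel_zero \<nu> H2 k"
  define a b where "a = eigenvalue \<nu> H1 n" and "b = eigenvalue \<nu> H2 k"
  have p0: "phi \<nu> 0 > (0::real)" by (rule phi_nonpos_pos[OF nu]) simp
  have goal: "bessel_coeff \<nu> H1 H2 n k = coeff_scale \<nu> H1 n * coeff_scale \<nu> H2 k * (phi \<nu> b * psi \<nu> a - phi \<nu> a * psi \<nu> b)"
  proof (cases "H1 + ereal \<nu> = 0 \<and> n = 0")
    case c1: True
    then have c2: "\<not> (H2 + ereal \<nu> = 0 \<and> k = 0)" using H by (cases H1; cases H2) auto
    have "y > 0" unfolding y_def by (rule bessel_zero_pos[OF H(2) k c2])
    then have psi_b: "zero_sign k * y * bessel_JI k (\<nu> + 1) y = (y / 2) powr \<nu> * psi \<nu> b"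
      using bessel_JI_eq_phi_psi(2)[of H2 k] by (simp add: y_def b_def)
    have a: "a = 0" using c1 by (simp add: a_def eigenvalue_def bessel_zero_def)
    have "bessel_coeff \<nu> H1 H2 n k = - sqrt (2 * (\<nu> + 1)) * bessel_const \<nu> H2 k * (zero_sign k * y * bessel_JI k (\<nu> + 1) y)"
      using c1 by (simp add: bessel_coeff_def Let_def y_def)
    then show ?thesis
      unfolding psi_b using c1 c2 p0 by (auto simp: coeff_scale_def a psi_def y_def)
  next
    case c1: False
    have "x > 0" unfolding x_def by (rule bessel_zero_pos[OF H(1) n c1])
    then have xa: "zero_sign n * x * bessel_JI n (\<nu> + 1) x = (x / 2) powr \<nu> * psi \<nu> a"
      "bessel_JI n \<nu> x = (x / 2) powr \<nu> * phi \<nu> a"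
      using bessel_JI_eq_phi_psi[of H1 n] by (simp_all add: x_def a_def)
    show ?thesis
    proof (cases "H2 + ereal \<nu> = 0 \<and> k = 0")
      case c2: True
      have b: "b = 0" using c2 by (simp add: b_def eigenvalue_def bessel_zero_def)
      have "bessel_coeff \<nu> H1 H2 n k = sqrt (2 * (\<nu> + 1)) * bessel_const \<nu> H1 n * (zero_sign n * x * bessel_JI n (\<nu> + 1) x)"
        using c1 c2 by (auto simp: bessel_coeff_def Let_def x_def)
      then show ?thesis
        unfolding xa using c1 c2 p0 by (auto simp: coeff_scale_def b psi_def x_def)
    next
      case c2: False
      have "y > 0" unfolding y_def by (rule bessel_zero_pos[OF H(2) k c2])
      then have yb: "zero_sign k * y * bessel_JI k (\<nu> + 1) y = (y / 2) powr \<nu> * psi \<nu> b"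
        "bessel_JI k \<nu> y = (y / 2) powr \<nu> * phi \<nu> b"
        using bessel_JI_eq_phi_psi[of H2 k] by (simp_all add: y_def b_def)
      have "bessel_coeff \<nu> H1 H2 n k = bessel_const \<nu> H1 n * bessel_const \<nu> H2 k *
          ((zero_sign n * x * bessel_JI n (\<nu> + 1) x) * bessel_JI k \<nu> y
           - bessel_JI n \<nu> x * (zero_sign k * y * bessel_JI k (\<nu> + 1) y))"
        unfolding bessel_coeff_def Let_def if_not_P[OF c1] if_not_P[OF c2] x_def y_def
        by (simp only: mult_ac)
      then show ?thesis
        unfolding xa yb using c1 c2 by (auto simp: coeff_scale_def x_def y_def algebra_simps)
    qed
  qed
  then show ?thesis by (simp only: bessel_ker_mult a_def b_def)
qed

end

theorem theorem3p2:
  fixes \<nu> :: real and H1 H2 :: ereal and n :: nat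
  assumes "\<nu> > - 1"
    and "H1 \<noteq> - \<infinity>" and "H2 \<noteq> - \<infinity>"
    and "H1 \<noteq> H2"
    and "n \<ge> of_bool (H1 + ereal \<nu> > 0)"
  shows "((\<lambda>k. \<bar>bessel_coeff \<nu> H1 H2 n k\<bar>\<^sup>2 /
              (zero_sign n * (bessel_zero \<nu> H1 n)\<^sup>2 - zero_sign k * (bessel_zero \<nu> H2 k)\<^sup>2)\<^sup>2)
          has_sum 1) {k. k \<ge> of_bool (H2 + ereal \<nu> > 0)}"
proof -
  define a where "a = eigenvalue \<nu> H1 n"
  let ?s = "coeff_scale \<nu> H1 n"
  have "bdry \<nu> H1 a = 0" unfolding a_def using assms by (intro eigenvalue_zero)
  then have a: "bdry \<nu> H2 a \<noteq> 0" using assms by (intro bdry_zeros_disjoint[of \<nu> H1 H2])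
  \<comment> \<open>Completeness at the point \<open>a\<close>, normalised by \<open>s\<^sup>2 * K(a,a) = 1\<close>.\<close>
  have "((\<lambda>t. ?s\<^sup>2 * (bessel_ker \<nu> t a * bessel_ker \<nu> t a / bessel_ker \<nu> t t)) has_sum ?s\<^sup>2 * bessel_ker \<nu> a a) (bdry_zeros \<nu> H2)"
    by (intro has_sum_cmult_right bessel_ker_expansion assms a)
  also have "?s\<^sup>2 * bessel_ker \<nu> a a = 1"
    unfolding a_def using assms by (intro coeff_scale_square)
  finally have "((\<lambda>k. ?s\<^sup>2 * (bessel_ker \<nu> (eigenvalue \<nu> H2 k) a * bessel_ker \<nu> (eigenvalue \<nu> H2 k) a
        / bessel_ker \<nu> (eigenvalue \<nu> H2 k) (eigenvalue \<nu> H2 k))) has_sum 1) {k. k \<ge> of_bool (H2 + ereal \<nu> > 0)}"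
    by (rule has_sum_reindex_bij_betw[OF eigenvalue_bij_betw[OF assms(1,3)], THEN iffD2])
  then show ?thesis
  proof (rule has_sum_cong[THEN iffD1, rotated])
    fix k :: nat assume "k \<in> {k. k \<ge> of_bool (H2 + ereal \<nu> > 0)}"
    then have k: "k \<ge> of_bool (H2 + ereal \<nu> > 0)" by simp
    define t where "t = eigenvalue \<nu> H2 k"
    let ?r = "coeff_scale \<nu> H2 k"
    have "bdry \<nu> H2 t = 0" unfolding t_def using assms k by (intro eigenvalue_zero)
    with a have at: "a - t \<noteq> 0" by auto
    have "?r\<^sup>2 * bessel_ker \<nu> t t = 1"
      unfolding t_def using assms k by (intro coeff_scale_square)
    then have r: "?r\<^sup>2 = 1 / bessel_ker \<nu> t t" 
      using bessel_ker_diag_pos[OF assms(1), of t] by (auto simp: eq_divide_eq)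
    have "bessel_coeff \<nu> H1 H2 n k = ?s * ?r * ((a - t) * bessel_ker \<nu> a t)"
      unfolding a_def t_def using assms k by (intro bessel_coeff_scale)
    moreover have "zero_sign n * (bessel_zero \<nu> H1 n)\<^sup>2 - zero_sign k * (bessel_zero \<nu> H2 k)\<^sup>2 = a - t"
      by (simp add: a_def t_def eigenvalue_def)
    ultimately have "\<bar>bessel_coeff \<nu> H1 H2 n k\<bar>\<^sup>2 /
        (zero_sign n * (bessel_zero \<nu> H1 n)\<^sup>2 - zero_sign k * (bessel_zero \<nu> H2 k)\<^sup>2)\<^sup>2
        = ?s\<^sup>2 * ?r\<^sup>2 * (bessel_ker \<nu> a t)\<^sup>2"
      using at by (simp add: power_mult_distrib)
    then show "?s\<^sup>2 * (bessel_ker \<nu> (eigenvalue \<nu> H2 k) a * bessel_ker \<nu> (eigenvalue \<nu> H2 k) a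
        / bessel_ker \<nu> (eigenvalue \<nu> H2 k) (eigenvalue \<nu> H2 k))
      = \<bar>bessel_coeff \<nu> H1 H2 n k\<bar>\<^sup>2 /
        (zero_sign n * (bessel_zero \<nu> H1 n)\<^sup>2 - zero_sign k * (bessel_zero \<nu> H2 k)\<^sup>2)\<^sup>2"
      unfolding r t_def[symmetric] bessel_ker_commute[of \<nu> a t] by (simp add: power2_eq_square)
  qed
qed

end
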